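(* Let $p$ be a prime, $q=p^k$, $n,d\ge1$, and write $d+1=s(q-q/p)+r$ with $s$ divisible by $p$ and $0<r\le p(q-q/p)$; let $t=\max(p+2,10)$. A function $f\colon\mathbb{F}_q^n\to\mathbb{F}_q$ passes the sparse $(s+t)$-flat test with probability $1$ (i.e. $\langle f\circ T,H_e\rangle=0$ for every affine $T\colon\mathbb{F}_q^{s+t}\to\mathbb{F}_q^n$ and every valid $e$) if and only if $f$ has degree at most $d$.
   Context: Functions $\mathbb{F}_q^m\to\mathbb{F}_q$ are identified with polynomials of individual degree $\le q-1$; degree means total degree. $\langle f,g\rangle=\sum_{v\in\mathbb{F}_q^m}f(v)g(v)$. For $x=(x_1,\dots,x_p)$ and $I\subseteq\{1,\dots,p\}$ write $x_I=\sum_{i\in I}x_i$. Let $P(x_1,\dots,x_p)$ be the polynomial $\big(\sum_{I\subseteq[p-1]}(-1)^{|I|+1}(x_I+x_p)^{q-1}\big)/(x_1\cdots x_{p-1})$ (the division is exact). For $e\in\{0,\dots,q-1\}^t$ let $H_e(x_1,\dots,x_{s+t})=\prod_{i=1}^{s/p}P(x_{p(i-1)+1},\dots,x_{pi})\cdot\prod_{i=1}^t x_{s+i}^{e_i}$. A vector $e\in\{0,\dots,q-1\}^t$ is valid if $\sum_{i=1}^t e_i\le t(q-1)-r$. The sparse $(s+t)$-flat test picks a uniformly random affine map $T\colon\mathbb{F}_q^{s+t}\to\mathbb{F}_q^n$ and accepts iff $\langle f\circ T,H_e\rangle=0$ for all valid $e$. *)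

theory Defs
  imports
    "Jordan_Normal_Form.Matrix"
    "HOL-Library.Poly_Mapping"
    "HOL-Library.Cardinality"
    "HOL-Library.FuncSet"
    "HOL-Computational_Algebra.Primes"
    "HOL-Computational_Algebra.Polynomial"
begin

text \<open>
  The finite field is a type of class \<open>{field, finite}\<close> with \<open>q = CARD('a)\<close> elements, and the
  space of \<open>m\<close>-tuples over it is \<open>carrier_vec m\<close>.  All coordinates and variables are indexed
  from \<open>0\<close>.  A function on \<open>m\<close>-tuples is a function on \<open>'a vec\<close> of which only the values on
  \<open>carrier_vec m\<close> matter.
\<close>

subsection \<open>Multivariate polynomials and the degree of a function\<close>

type_synonym 'a mpoly = "(nat \<Rightarrow>\<^sub>0 nat) \<Rightarrow>\<^sub>0 'a"

definition Var :: "nat \<Rightarrow> 'a::comm_ring_1 mpoly" where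
  "Var i = Poly_Mapping.single (Poly_Mapping.single i 1) 1"

definition eval_monom :: "(nat \<Rightarrow> 'a) \<Rightarrow> (nat \<Rightarrow>\<^sub>0 nat) \<Rightarrow> 'a::comm_ring_1" where
  "eval_monom x m = (\<Prod>i\<in>Poly_Mapping.keys m. x i ^ Poly_Mapping.lookup m i)"

definition eval_mpoly :: "(nat \<Rightarrow> 'a) \<Rightarrow> 'a mpoly \<Rightarrow> 'a::comm_ring_1" where
  "eval_mpoly x F = (\<Sum>m\<in>Poly_Mapping.keys F. Poly_Mapping.lookup F m * eval_monom x m)"

definition monom_degree :: "(nat \<Rightarrow>\<^sub>0 nat) \<Rightarrow> nat" where
  "monom_degree m = (\<Sum>i\<in>Poly_Mapping.keys m. Poly_Mapping.lookup m i)"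

text \<open>The zero polynomial gets total degree \<open>0\<close>.\<close>

definition total_degree :: "'a::zero mpoly \<Rightarrow> nat" where
  "total_degree F = Max (insert 0 (monom_degree ` Poly_Mapping.keys F))"

definition reduced_mpolys :: "nat \<Rightarrow> 'a::{field,finite} mpoly set" where
  "reduced_mpolys n = {F. \<forall>m\<in>Poly_Mapping.keys F.
     Poly_Mapping.keys m \<subseteq> {..<n} \<and> (\<forall>i. Poly_Mapping.lookup m i \<le> CARD('a) - 1)}"

definition mpoly_of_fun :: "nat \<Rightarrow> ('a vec \<Rightarrow> 'a) \<Rightarrow> 'a::{field,finite} mpoly" where
  "mpoly_of_fun n f =
     (THE F. F \<in> reduced_mpolys n \<and> (\<forall>v\<in>carrier_vec n. eval_mpoly (($) v) F = f v))"

definition fun_degree :: "nat \<Rightarrow> ('a vec \<Rightarrow> 'a::{field,finite}) \<Rightarrow> nat" where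
  "fun_degree n f = total_degree (mpoly_of_fun n f)"

subsection \<open>The sparse flat test\<close>

definition fun_inner :: "nat \<Rightarrow> ('a vec \<Rightarrow> 'a) \<Rightarrow> ('a vec \<Rightarrow> 'a) \<Rightarrow> 'a::{field,finite}" where
  "fun_inner m f g = (\<Sum>v\<in>carrier_vec m. f v * g v)"

definition sparse_P_num :: "nat \<Rightarrow> 'a::{field,finite} mpoly" where
  "sparse_P_num p =
     (\<Sum>I\<in>Pow {..<p - 1}. (-1) ^ (card I + 1) * ((\<Sum>i\<in>I. Var i) + Var (p - 1)) ^ (CARD('a) - 1))"

definition sparse_P :: "nat \<Rightarrow> 'a::{field,finite} mpoly" where
  "sparse_P p = (THE P. P * (\<Prod>i<p - 1. Var i) = sparse_P_num p)"

definition sparse_H :: "nat \<Rightarrow> nat \<Rightarrow> nat \<Rightarrow> nat vec \<Rightarrow> 'a vec \<Rightarrow> 'a::{field,finite}" where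
  "sparse_H p s t e x =
     (\<Prod>i<s div p. eval_mpoly (\<lambda>j. x $ (p * i + j)) (sparse_P p)) * (\<Prod>i<t. (x $ (s + i)) ^ (e $ i))"

definition valid_exps :: "nat \<Rightarrow> nat \<Rightarrow> nat \<Rightarrow> nat vec set" where
  "valid_exps q t r = {e \<in> carrier_vec t. (\<forall>i<t. e $ i \<le> q - 1) \<and>
     int (\<Sum>i<t. e $ i) \<le> int t * (int q - 1) - int r}"

definition affine_maps :: "nat \<Rightarrow> nat \<Rightarrow> ('a vec \<Rightarrow> 'a::{field,finite} vec) set" where
  "affine_maps m n = {(\<lambda>x. A *\<^sub>v x + b) | A b. A \<in> carrier_mat n m \<and> b \<in> carrier_vec n}"

definition sparse_test_accepts ::
  "nat \<Rightarrow> nat \<Rightarrow> nat \<Rightarrow> nat \<Rightarrow> ('a vec \<Rightarrow> 'a::{field,finite}) \<Rightarrow> ('a vec \<Rightarrow> 'a vec) \<Rightarrow> bool" where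
  "sparse_test_accepts p s t r f T \<longleftrightarrow>
     (\<forall>e\<in>valid_exps CARD('a) t r. fun_inner (s + t) (f \<circ> T) (sparse_H p s t e) = 0)"

definition sparse_test_prob ::
  "nat \<Rightarrow> nat \<Rightarrow> nat \<Rightarrow> nat \<Rightarrow> nat \<Rightarrow> ('a vec \<Rightarrow> 'a::{field,finite}) \<Rightarrow> real" where
  "sparse_test_prob p n s t r f =
     real (card {T \<in> affine_maps (s + t) n. sparse_test_accepts p s t r f T}) /
     real (card (affine_maps (s + t) n :: ('a vec \<Rightarrow> 'a vec) set))"

subsection \<open>The definitions are meaningful\<close>

lemma bij_carrier_vec:
  "bij_betw (\<lambda>v. restrict (($) v) {..<n}) (carrier_vec n) ({..<n} \<rightarrow>\<^sub>E (UNIV :: 'a set))"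
  by (rule bij_betwI[where g = "vec n"]) (auto simp: fun_eq_iff PiE_def extensional_def)

lemma finite_carrier_vec [simp]: "finite (carrier_vec n :: 'a::finite vec set)"
  using bij_betw_finite[OF bij_carrier_vec] by (metis finite_PiE finite_lessThan finite)

lemma card_carrier_vec: "card (carrier_vec n :: 'a::finite vec set) = CARD('a) ^ n"
  using bij_betw_same_card[OF bij_carrier_vec, of n] by (simp add: card_PiE)

lemma finite_carrier_mat [simp]: "finite (carrier_mat n m :: 'a::finite mat set)"
proof -
  have "carrier_mat n m \<subseteq> (mat n m :: _ \<Rightarrow> 'a mat) ` (({..<n} \<times> {..<m}) \<rightarrow>\<^sub>E UNIV)"
  proof
    fix A :: "'a mat" assume A: "A \<in> carrier_mat n m"
    then have "A = mat n m (restrict (($$) A) ({..<n} \<times> {..<m}))"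
      by (intro eq_matI) auto
    then show "A \<in> (mat n m :: _ \<Rightarrow> 'a mat) ` (({..<n} \<times> {..<m}) \<rightarrow>\<^sub>E UNIV)"
      by (metis (no_types, lifting) UNIV_I image_eqI restrict_PiE_iff)
  qed
  then show ?thesis
    by (rule finite_subset) (intro finite_imageI finite_PiE, auto)
qed

lemma finite_affine_maps [simp]: "finite (affine_maps m n :: ('a vec \<Rightarrow> 'a::{field,finite} vec) set)"
proof -
  have "affine_maps m n = (\<lambda>(A, b) x. A *\<^sub>v x + b) ` (carrier_mat n m \<times> (carrier_vec n :: 'a vec set))"
    unfolding affine_maps_def by force
  then show ?thesis by simp
qed

lemma affine_maps_nonempty: "(affine_maps m n :: ('a vec \<Rightarrow> 'a::{field,finite} vec) set) \<noteq> {}"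
proof -
  have "(\<lambda>x. 0\<^sub>m n m *\<^sub>v x + 0\<^sub>v n) \<in> (affine_maps m n :: ('a vec \<Rightarrow> 'a vec) set)"
    unfolding affine_maps_def by (intro CollectI exI conjI) (rule refl, auto)
  then show ?thesis by blast
qed

lemma sparse_test_prob_eq_1_iff:
  fixes f :: "'a vec \<Rightarrow> 'a::{field,finite}"
  shows "sparse_test_prob p n s t r f = 1 \<longleftrightarrow>
    (\<forall>T\<in>affine_maps (s + t) n. \<forall>e\<in>valid_exps CARD('a) t r.
       fun_inner (s + t) (f \<circ> T) (sparse_H p s t e) = 0)"
proof -
  let ?A = "affine_maps (s + t) n :: ('a vec \<Rightarrow> 'a vec) set"
  let ?B = "{T \<in> ?A. sparse_test_accepts p s t r f T}"
  have "card ?A > 0" using affine_maps_nonempty[of "s + t" n] by (simp add: card_gt_0_iff)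
  then have "sparse_test_prob p n s t r f = 1 \<longleftrightarrow> card ?B = card ?A"
    unfolding sparse_test_prob_def by (auto simp: divide_eq_1_iff)
  also have "\<dots> \<longleftrightarrow> ?B = ?A"
    using card_subset_eq[of ?A ?B] by auto
  also have "\<dots> \<longleftrightarrow> (\<forall>T\<in>?A. sparse_test_accepts p s t r f T)" by blast
  finally show ?thesis unfolding sparse_test_accepts_def .
qed

lemma eval_mpoly_superset:
  assumes "finite S" "Poly_Mapping.keys F \<subseteq> S"
  shows "eval_mpoly x F = (\<Sum>m\<in>S. Poly_Mapping.lookup F m * eval_monom x m)"
  unfolding eval_mpoly_def using assms
  by (intro sum.mono_neutral_left) (auto simp: in_keys_iff)

lemma eval_mpoly_zero [simp]: "eval_mpoly x 0 = 0"
  by (simp add: eval_mpoly_def)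

lemma eval_mpoly_add: "eval_mpoly x (F + G) = eval_mpoly x F + eval_mpoly x G"
proof -
  let ?S = "Poly_Mapping.keys F \<union> Poly_Mapping.keys G"
  have "Poly_Mapping.keys (F + G) \<subseteq> ?S" by (rule Poly_Mapping.keys_add)
  then show ?thesis
    by (simp add: eval_mpoly_superset[of ?S] lookup_add ring_distribs sum.distrib)
qed

lemma eval_mpoly_sum: "eval_mpoly x (\<Sum>i\<in>A. F i) = (\<Sum>i\<in>A. eval_mpoly x (F i))"
  by (induction A rule: infinite_finite_induct) (auto simp: eval_mpoly_add)

lemma eval_mpoly_single: "eval_mpoly x (Poly_Mapping.single m c) = c * eval_monom x m"
  by (cases "c = 0") (auto simp: eval_mpoly_def)

lemma lookup_sum_single:
  fixes n :: nat
  shows "Poly_Mapping.lookup (\<Sum>i<n. Poly_Mapping.single i (e i)) j = (if j < n then e j else (0::nat))"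
  by (induction n) (auto simp: lookup_add lookup_single when_def less_Suc_eq)

lemma eval_monom_sum_single:
  fixes n :: nat
  shows "eval_monom x (\<Sum>i<n. Poly_Mapping.single i (e i)) = (\<Prod>i<n. x i ^ e i)"
  unfolding eval_monom_def
  by (subst prod.mono_neutral_left[of "{..<n}"])
     (auto simp: lookup_sum_single in_keys_iff split: if_splits)

lemma indicator_poly:
  fixes v :: "'a::{field,finite}"
  obtains L :: "'a poly" where "degree L \<le> CARD('a) - 1" "\<And>x. poly L x = (if x = v then 1 else 0)"
proof
  let ?L = "\<Prod>w\<in>UNIV - {v}. [:- (w / (v - w)), 1 / (v - w):]"
  have "degree ?L \<le> (\<Sum>w\<in>UNIV - {v}. degree [:- (w / (v - w)), 1 / (v - w):])"
    using degree_prod_sum_le[of "UNIV - {v}" "\<lambda>w. [:- (w / (v - w)), 1 / (v - w):]"]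
    by (simp add: o_def)
  also have "\<dots> \<le> (\<Sum>w\<in>UNIV - {v}. 1)" by (intro sum_mono) auto
  finally show "degree ?L \<le> CARD('a) - 1" by (simp add: card_Diff_singleton)
  show "poly ?L x = (if x = v then 1 else 0)" for x
  proof (cases "x = v")
    case True
    have "poly [:- (w / (v - w)), 1 / (v - w):] v = 1" if "w \<noteq> v" for w
      using that by (simp add: diff_divide_distrib[symmetric])
    then show ?thesis using True by (simp add: poly_prod del: poly_pCons)
  next
    case False
    have "poly [:- (x / (v - x)), 1 / (v - x):] x = 0" using False by (simp add: field_simps)
    then have "poly ?L x = 0" unfolding poly_prod
      using False by (subst prod_zero_iff) (auto intro!: bexI[of _ x])
    then show ?thesis using False by simp
  qed
qed

lemma reduced_mpoly_exists:
  fixes f :: "'a vec \<Rightarrow> 'a::{field,finite}"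
  shows "\<exists>F\<in>reduced_mpolys n. \<forall>v\<in>carrier_vec n. eval_mpoly (($) v) F = f v"
proof -
  let ?q = "CARD('a)"
  have "\<exists>L. \<forall>v::'a. degree (L v) \<le> ?q - 1 \<and> (\<forall>x. poly (L v) x = (if x = v then 1 else 0))"
    by (intro choice allI) (metis indicator_poly)
  then obtain L :: "'a \<Rightarrow> 'a poly" where
    L: "\<And>v. degree (L v) \<le> ?q - 1" "\<And>v x. poly (L v) x = (if x = v then 1 else 0)" by blast
  define M where "M e = (\<Sum>i<n. Poly_Mapping.single i (e i :: nat))" for e
  define E where "E = {..<n} \<rightarrow>\<^sub>E {..?q - 1}"
  define c where "c e = (\<Sum>w\<in>carrier_vec n. f w * (\<Prod>i<n. coeff (L (w $ i)) (e i)))" for e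
  define F where "F = (\<Sum>e\<in>E. Poly_Mapping.single (M e) (c e))"
  have finE: "finite E" unfolding E_def by (intro finite_PiE) auto
  have "Poly_Mapping.keys F \<subseteq> M ` E"
  proof -
    have "Poly_Mapping.keys F \<subseteq> (\<Union>e\<in>E. Poly_Mapping.keys (Poly_Mapping.single (M e) (c e)))"
      unfolding F_def by (rule Poly_Mapping.keys_sum)
    also have "\<dots> \<subseteq> M ` E" by (auto split: if_splits)
    finally show ?thesis .
  qed
  moreover have "Poly_Mapping.keys (M e) \<subseteq> {..<n} \<and> (\<forall>i. Poly_Mapping.lookup (M e) i \<le> ?q - 1)"
    if "e \<in> E" for e
    using that unfolding M_def E_def
    by (auto simp: in_keys_iff lookup_sum_single PiE_iff split: if_splits)
  ultimately have "F \<in> reduced_mpolys n" unfolding reduced_mpolys_def by blast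
  moreover have "eval_mpoly (($) v) F = f v" if v: "v \<in> carrier_vec n" for v
  proof -
    have pL: "poly (L a) x = (\<Sum>j\<le>?q - 1. coeff (L a) j * x ^ j)" for a x
      unfolding poly_altdef using L(1)[of a]
      by (intro sum.mono_neutral_left) (auto intro: coeff_eq_0)
    have "eval_mpoly (($) v) F = (\<Sum>e\<in>E. c e * (\<Prod>i<n. (v $ i) ^ e i))"
      by (simp add: F_def M_def eval_mpoly_sum eval_mpoly_single eval_monom_sum_single)
    also have "\<dots> = (\<Sum>w\<in>carrier_vec n. f w *
        (\<Sum>e\<in>E. \<Prod>i<n. coeff (L (w $ i)) (e i) * (v $ i) ^ e i))"
      unfolding c_def sum_distrib_right sum_distrib_left
      by (subst sum.swap) (simp add: prod.distrib mult.assoc)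
    also have "\<dots> = (\<Sum>w\<in>carrier_vec n. f w * (\<Prod>i<n. poly (L (w $ i)) (v $ i)))"
      unfolding pL E_def by (subst prod_sum_PiE) auto
    also have "\<dots> = (\<Sum>w\<in>carrier_vec n. if w = v then f w else 0)"
    proof (rule sum.cong[OF refl])
      fix w :: "'a vec" assume w: "w \<in> carrier_vec n"
      show "f w * (\<Prod>i<n. poly (L (w $ i)) (v $ i)) = (if w = v then f w else 0)"
      proof (cases "w = v")
        case True then show ?thesis by (simp add: L(2))
      next
        case False
        then obtain i where "i < n" "w $ i \<noteq> v $ i" using v w by (metis carrier_vecD eq_vecI)
        then have "(\<Prod>i<n. poly (L (w $ i)) (v $ i)) = 0"
          by (subst prod_zero_iff) (auto simp: L(2) intro!: bexI[of _ i])
        then show ?thesis using False by simp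
      qed
    qed
    also have "\<dots> = f v" using v by (simp add: sum.delta)
    finally show ?thesis .
  qed
  ultimately show ?thesis by blast
qed

lemma reduced_mpoly_inj:
  "inj_on (\<lambda>F. restrict (\<lambda>v. eval_mpoly (($) v) F) (carrier_vec n))
     (reduced_mpolys n :: 'a::{field,finite} mpoly set)" (is "inj_on ?ev ?R")
proof -
  let ?q = "CARD('a)" and ?C = "carrier_vec n :: 'a vec set"
  define RM where "RM = {m :: nat \<Rightarrow>\<^sub>0 nat.
    Poly_Mapping.keys m \<subseteq> {..<n} \<and> (\<forall>i. Poly_Mapping.lookup m i \<le> ?q - 1)}"
  have R: "F \<in> ?R \<longleftrightarrow> Poly_Mapping.keys F \<subseteq> RM" for F
    unfolding reduced_mpolys_def RM_def by blast
  let ?g = "\<lambda>m :: nat \<Rightarrow>\<^sub>0 nat. restrict (Poly_Mapping.lookup m) {..<n}"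
  have g: "inj_on ?g RM"
  proof (rule inj_onI)
    fix a b assume ab: "a \<in> RM" "b \<in> RM" "?g a = ?g b"
    show "a = b"
    proof (rule poly_mapping_eqI)
      fix i show "Poly_Mapping.lookup a i = Poly_Mapping.lookup b i"
      proof (cases "i < n")
        case True then show ?thesis using fun_cong[OF ab(3), of i] by simp
      next
        case False
        then have "i \<notin> Poly_Mapping.keys a" "i \<notin> Poly_Mapping.keys b"
          using ab(1,2) unfolding RM_def by auto
        then show ?thesis by (simp add: in_keys_iff)
      qed
    qed
  qed
  have g': "?g ` RM \<subseteq> {..<n} \<rightarrow>\<^sub>E {..?q - 1}" unfolding RM_def by (auto split: if_splits)
  have fin: "finite ({..<n} \<rightarrow>\<^sub>E {..?q - 1})" by (intro finite_PiE) auto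
  have finRM: "finite RM" using g g' fin by (metis finite_imageD finite_subset)
  have "card RM \<le> card ({..<n} \<rightarrow>\<^sub>E {..?q - 1})" using g g' fin by (metis card_inj_on_le)
  also have "\<dots> = ?q ^ n" by (simp add: card_PiE)
  finally have cRM: "card RM \<le> ?q ^ n" .
  let ?h = "\<lambda>F :: 'a mpoly. restrict (Poly_Mapping.lookup F) RM"
  have h: "inj_on ?h ?R"
  proof (rule inj_onI)
    fix a b assume ab: "a \<in> ?R" "b \<in> ?R" "?h a = ?h b"
    show "a = b"
    proof (rule poly_mapping_eqI)
      fix i show "Poly_Mapping.lookup a i = Poly_Mapping.lookup b i"
      proof (cases "i \<in> RM")
        case True then show ?thesis using fun_cong[OF ab(3), of i] by simp
      next
        case False
        then have "i \<notin> Poly_Mapping.keys a" "i \<notin> Poly_Mapping.keys b"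
          using ab(1,2) unfolding R by auto
        then show ?thesis by (simp add: in_keys_iff)
      qed
    qed
  qed
  have h': "?h ` ?R \<subseteq> RM \<rightarrow>\<^sub>E UNIV" by auto
  have fin': "finite (RM \<rightarrow>\<^sub>E (UNIV :: 'a set))" using finRM by (intro finite_PiE) auto
  have finR: "finite ?R" using h h' fin' by (metis finite_imageD finite_subset)
  have "card ?R \<le> card (RM \<rightarrow>\<^sub>E (UNIV :: 'a set))" using h h' fin' by (metis card_inj_on_le)
  also have "\<dots> = ?q ^ card RM" using finRM by (simp add: card_PiE)
  also have "\<dots> \<le> ?q ^ (?q ^ n)" using cRM by (intro power_increasing) (auto simp: Suc_leI)
  also have "\<dots> = card (?C \<rightarrow>\<^sub>E (UNIV :: 'a set))"
    by (simp add: card_PiE card_carrier_vec)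
  also have "\<dots> \<le> card (?ev ` ?R)"
  proof (rule card_mono)
    show "finite (?ev ` ?R)" using finR by simp
    show "?C \<rightarrow>\<^sub>E UNIV \<subseteq> ?ev ` ?R"
    proof
      fix f :: "'a vec \<Rightarrow> 'a" assume f: "f \<in> ?C \<rightarrow>\<^sub>E UNIV"
      obtain F where "F \<in> ?R" "\<forall>v\<in>?C. eval_mpoly (($) v) F = f v"
        using reduced_mpoly_exists by blast
      then have "f = ?ev F" using f by (auto simp: fun_eq_iff PiE_def extensional_def)
      with \<open>F \<in> ?R\<close> show "f \<in> ?ev ` ?R" by blast
    qed
  qed
  finally have "card ?R \<le> card (?ev ` ?R)" .
  then show ?thesis using finR by (metis card_image_le eq_card_imp_inj_on le_antisym)
qed

lemma reduced_mpoly_ex1: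
  fixes f :: "'a vec \<Rightarrow> 'a::{field,finite}"
  shows "\<exists>!F. F \<in> reduced_mpolys n \<and> (\<forall>v\<in>carrier_vec n. eval_mpoly (($) v) F = f v)"
proof (rule ex_ex1I)
  show "\<exists>F. F \<in> reduced_mpolys n \<and> (\<forall>v\<in>carrier_vec n. eval_mpoly (($) v) F = f v)"
    using reduced_mpoly_exists by blast
next
  fix F G :: "'a mpoly"
  assume F: "F \<in> reduced_mpolys n \<and> (\<forall>v\<in>carrier_vec n. eval_mpoly (($) v) F = f v)"
    and G: "G \<in> reduced_mpolys n \<and> (\<forall>v\<in>carrier_vec n. eval_mpoly (($) v) G = f v)"
  show "F = G"
    by (rule inj_onD[OF reduced_mpoly_inj]) (use F G in \<open>auto intro!: restrict_ext\<close>)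
qed

lemma mpoly_of_fun:
  fixes f :: "'a vec \<Rightarrow> 'a::{field,finite}"
  shows "mpoly_of_fun n f \<in> reduced_mpolys n"
    and "\<And>v. v \<in> carrier_vec n \<Longrightarrow> eval_mpoly (($) v) (mpoly_of_fun n f) = f v"
  using theI'[OF reduced_mpoly_ex1[of n f]] unfolding mpoly_of_fun_def by blast+

lemma poly_shift_difference:
  fixes a :: "'b::comm_ring_1"
  shows "\<exists>g. \<forall>y. poly f y - poly f (a + y) = poly g y * a"
proof (induction f)
  case 0 show ?case by (intro exI[of _ 0]) simp
next
  case (pCons c f)
  then obtain g where g: "\<And>y. poly f y - poly f (a + y) = poly g y * a" by blast
  show ?case
  proof (intro exI[of _ "[:0, 1:] * g - pcompose f [:a, 1:]"] allI)
    fix y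
    have "poly (pCons c f) y - poly (pCons c f) (a + y) =
        y * (poly f y - poly f (a + y)) - a * poly f (a + y)"
      by (simp add: algebra_simps)
    also have "\<dots> = poly ([:0, 1:] * g - pcompose f [:a, 1:]) y * a"
      unfolding g by (simp add: poly_pcompose algebra_simps)
    finally show "poly (pCons c f) y - poly (pCons c f) (a + y) =
      poly ([:0, 1:] * g - pcompose f [:a, 1:]) y * a" .
  qed
qed

lemma iterated_difference:
  fixes x :: "nat \<Rightarrow> 'b::comm_ring_1"
  assumes "finite J"
  shows "\<exists>g. \<forall>y. (\<Sum>I\<in>Pow J. (-1) ^ card I * ((\<Sum>i\<in>I. x i) + y) ^ N) = poly g y * (\<Prod>i\<in>J. x i)"
  using assms
proof (induction J rule: finite_induct)
  case empty
  show ?case by (intro exI[of _ "monom 1 N"]) (simp add: poly_monom)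
next
  case (insert a J)
  let ?S = "\<lambda>J y. \<Sum>I\<in>Pow J. (-1) ^ card I * ((\<Sum>i\<in>I. x i) + y) ^ N"
  obtain f where f: "\<And>y. ?S J y = poly f y * (\<Prod>i\<in>J. x i)" using insert.IH by blast
  obtain g where g: "\<And>y. poly f y - poly f (x a + y) = poly g y * x a"
    using poly_shift_difference[of f "x a"] by blast
  have inj: "inj_on (insert a) (Pow J)"
    by (rule inj_onI) (metis PowD insert.hyps(2) insert_ident subsetD)
  have "?S (insert a J) y = poly g y * (\<Prod>i\<in>insert a J. x i)" for y
  proof -
    have "?S (insert a J) y = ?S J y + (\<Sum>I\<in>insert a ` Pow J. (-1) ^ card I * ((\<Sum>i\<in>I. x i) + y) ^ N)"
      unfolding Pow_insert using insert.hyps by (intro sum.union_disjoint) auto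
    also have "(\<Sum>I\<in>insert a ` Pow J. (-1) ^ card I * ((\<Sum>i\<in>I. x i) + y) ^ N) =
        (\<Sum>I\<in>Pow J. - ((-1) ^ card I * ((\<Sum>i\<in>I. x i) + (x a + y)) ^ N))"
      unfolding sum.reindex[OF inj]
    proof (rule sum.cong[OF refl])
      fix I assume I: "I \<in> Pow J"
      then have "finite I" "a \<notin> I" using insert.hyps by (auto intro: finite_subset)
      then show "((\<lambda>I. (-1) ^ card I * ((\<Sum>i\<in>I. x i) + y) ^ N) \<circ> insert a) I =
        - ((-1) ^ card I * ((\<Sum>i\<in>I. x i) + (x a + y)) ^ N)"
        by (simp add: ac_simps)
    qed
    also have "\<dots> = - ?S J (x a + y)" by (rule sum_negf)
    also have "?S J y + - ?S J (x a + y) = (poly f y - poly f (x a + y)) * (\<Prod>i\<in>J. x i)"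
      unfolding f by (simp add: algebra_simps)
    also have "\<dots> = poly g y * (\<Prod>i\<in>insert a J. x i)"
      unfolding g using insert.hyps by (simp add: algebra_simps)
    finally show ?thesis .
  qed
  then show ?case by blast
qed

lemma Var_nonzero: "Var i \<noteq> (0 :: 'a::comm_ring_1 mpoly)"
  unfolding Var_def by (metis lookup_single_eq lookup_zero zero_neq_one)

lemma sparse_P_ex1: "\<exists>!P. P * (\<Prod>i<p - 1. Var i) = (sparse_P_num p :: 'a::{field,finite} mpoly)"
proof (rule ex_ex1I)
  obtain g :: "'a mpoly poly" where
    g: "(\<Sum>I\<in>Pow {..<p - 1}. (-1) ^ card I * ((\<Sum>i\<in>I. Var i) + Var (p - 1)) ^ (CARD('a) - 1)) =
        poly g (Var (p - 1)) * (\<Prod>i<p - 1. Var i)"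
    using iterated_difference[of "{..<p - 1}" Var "CARD('a) - 1"] by blast
  have "sparse_P_num p = - (poly g (Var (p - 1)) * (\<Prod>i<p - 1. Var i))"
    unfolding g[symmetric] sparse_P_num_def by (simp add: sum_negf)
  then show "\<exists>P. P * (\<Prod>i<p - 1. Var i) = (sparse_P_num p :: 'a mpoly)"
    by (metis mult_minus_left)
next
  fix P Q :: "'a mpoly"
  assume "P * (\<Prod>i<p - 1. Var i) = sparse_P_num p" "Q * (\<Prod>i<p - 1. Var i) = sparse_P_num p"
  moreover have "(\<Prod>i<p - 1. Var i) \<noteq> (0 :: 'a mpoly)"
    by (subst prod_zero_iff) (auto simp: Var_nonzero)
  ultimately show "P = Q" by (metis mult_cancel_right)
qed

lemma sparse_P: "sparse_P p * (\<Prod>i<p - 1. Var i) = (sparse_P_num p :: 'a::{field,finite} mpoly)"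
  unfolding sparse_P_def by (rule theI'[OF sparse_P_ex1])

end

theory Submission
  imports Defs
begin

text \<open>
  Write \<open>q = CARD('a)\<close> and \<open>Q = q - q div p\<close>. The sum over \<open>F_q^M\<close> of a polynomial of degree below
  \<open>M * (q - 1)\<close> vanishes, and \<open>H_e\<close> has degree at most \<open>(s / p) * (q - p) + t * (q - 1) - r\<close>; this
  settles functions of degree at most \<open>d\<close>.

  Conversely, let \<open>x^a\<close> be a monomial of \<open>f\<close> with \<open>|a| > d\<close>. The inner product of \<open>f \<circ> T\<close> with \<open>H_e\<close> is a
  reduced polynomial in the entries of \<open>T\<close>, so if it always vanishes, then so do its coefficients. These
  are the coefficients of \<open>f\<close> times products of multinomial coefficients \<open>(a_i; c_i0, c_i1, ...)\<close> times
  the inner product of \<open>\<Prod>j. y_j^(b_j)\<close> with \<open>H_e\<close>, where \<open>b_j = \<Sum>i. c_ij\<close>. By Lucas' theorem the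
  multinomial coefficients are nonzero when the \<open>c_ij\<close> arise by distributing the base-\<open>p\<close> digits of the
  \<open>a_i\<close>, seen as tokens of value \<open>p^l\<close>, among bins \<open>j\<close>. As the token values form a chain of divisors of
  \<open>Q\<close>, the bins can be filled one after the other up to exactly \<open>Q\<close>. The first \<open>s\<close> bins are then full,
  and the next \<open>t\<close> bins hold at least \<open>r\<close> in total, so that \<open>e_i = q - 1 - b_(s+i)\<close> is valid. Finally
  the inner product of \<open>\<Prod>j. y_j^Q\<close> with \<open>P\<close> is, up to sign, the multinomial coefficient
  \<open>(Q; q/p, ..., q/p)\<close>, which is again nonzero.
\<close>

subsection \<open>Power sums over a finite field\<close>

text \<open>The translation \<open>x + 1\<close> permutes the field, so the sum of all elements
  equals itself plus \<open>CARD('a)\<close> copies of 1.\<close>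

lemma of_nat_CARD_eq_0: "of_nat CARD('a) = (0 :: 'a::{field,finite})"
proof -
  have "(\<Sum>x\<in>UNIV. x + 1) = (\<Sum>x\<in>UNIV. x :: 'a)"
    by (rule sum.reindex_bij_witness[of _ "\<lambda>x. x - 1" "\<lambda>x. x + 1"]) auto
  then show ?thesis by (simp add: sum.distrib)
qed

lemma CARD_field_gt_1: "CARD('a::{field,finite}) > 1"
  using card_mono[of "UNIV :: 'a set" "{0, 1}"] by simp

lemma CHAR_eq_of_CARD_prime_power:
  assumes "prime p" "CARD('a::{field,finite}) = p ^ k"
  shows "CHAR('a) = p"
proof -
  have "(of_nat p :: 'a) ^ k = 0"
    using of_nat_CARD_eq_0[where 'a = 'a] assms(2) by simp
  then have "CHAR('a) dvd p" by (simp add: of_nat_eq_0_iff_char_dvd)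
  moreover have "CHAR('a) \<noteq> 1"
    by (metis of_nat_1 of_nat_CHAR zero_neq_one)
  ultimately show ?thesis using assms(1) by (auto simp: prime_nat_iff)
qed

text \<open>Multiplication by \<open>x\<close> permutes the nonzero elements. Comparing their
  product before and after, the product cancels.\<close>

lemma field_power_CARD_minus_1:
  fixes x :: "'a::{field,finite}"
  assumes "x \<noteq> 0"
  shows "x ^ (CARD('a) - 1) = 1"
proof -
  have "(\<Prod>y\<in>UNIV-{0}. x * y) = (\<Prod>y\<in>UNIV-{0}. y)"
    by (rule prod.reindex_bij_witness[of _ "\<lambda>y. y / x" "\<lambda>y. x * y"]) (use assms in auto)
  then have "x ^ (CARD('a) - 1) * (\<Prod>y\<in>UNIV-{0}. y) = (\<Prod>y\<in>UNIV-{0}. y)"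
    by (simp add: prod.distrib card_Diff_singleton)
  moreover have "(\<Prod>y\<in>UNIV-{0::'a}. y) \<noteq> 0" by (subst prod_zero_iff) auto
  ultimately show ?thesis by simp
qed

lemma field_power_CARD_minus_1_if:
  "(x :: 'a::{field,finite}) ^ (CARD('a) - 1) = (if x = 0 then 0 else 1)"
  using field_power_CARD_minus_1[of x] CARD_field_gt_1[where 'a = 'a] by (simp add: power_0_left)

text \<open>Substituting \<open>a * x\<close> for \<open>x\<close> multiplies the sum by
  \<open>a ^ e\<close>. For \<open>e > 0\<close> some nonzero \<open>a\<close> has
  \<open>a ^ e\<close> different from 1, because \<open>X^e - 1\<close> has at most
  \<open>e < q - 1\<close> roots. For \<open>e = 0\<close> every term is 1, also at 0, and the sum
  is \<open>q\<close> times 1.\<close>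

lemma power_sum_eq_0:
  assumes "e < CARD('a::{field,finite}) - 1"
  shows "(\<Sum>x\<in>UNIV. (x :: 'a) ^ e) = 0"
proof (cases "e = 0")
  case True
  then show ?thesis by (simp add: of_nat_CARD_eq_0)
next
  case False
  let ?P = "monom 1 e - 1 :: 'a poly"
  have "coeff ?P e = 1" using False by simp
  then have P0: "?P \<noteq> 0" by (metis coeff_0 zero_neq_one)
  have dP: "degree ?P \<le> e" by (rule degree_diff_le) (auto simp: degree_monom_le)
  have "\<exists>a. a \<noteq> 0 \<and> a ^ e \<noteq> (1::'a)"
  proof (rule ccontr)
    assume "\<not> ?thesis"
    then have "UNIV - {0} \<subseteq> {x. poly ?P x = 0}" by (auto simp: poly_monom)
    then have "card (UNIV - {0::'a}) \<le> card {x. poly ?P x = 0}" by (intro card_mono) auto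
    also have "\<dots> \<le> e" using card_poly_roots_bound[OF P0] dP by simp
    finally show False using assms by (simp add: card_Diff_singleton)
  qed
  then obtain a :: 'a where a: "a \<noteq> 0" "a ^ e \<noteq> 1" by blast
  have "(\<Sum>x\<in>UNIV. (a * x) ^ e) = (\<Sum>x\<in>UNIV. x ^ e)"
    by (rule sum.reindex_bij_witness[of _ "\<lambda>y. y / a" "\<lambda>y. a * y"]) (use a in auto)
  then have "(a ^ e - 1) * (\<Sum>x\<in>UNIV. x ^ e) = 0"
    by (simp add: power_mult_distrib sum_distrib_left[symmetric] left_diff_distrib)
  then show ?thesis using a by simp
qed

lemma power_sum_CARD_minus_1: "(\<Sum>x\<in>UNIV. (x :: 'a::{field,finite}) ^ (CARD('a) - 1)) = -1"
proof -
  have "(\<Sum>x\<in>UNIV. (x :: 'a) ^ (CARD('a) - 1)) = (\<Sum>x\<in>UNIV-{0::'a}. (1 :: 'a))"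
    unfolding field_power_CARD_minus_1_if by (intro sum.mono_neutral_cong_right) auto
  also have "\<dots> = of_nat CARD('a) - 1"
    using CARD_field_gt_1[where 'a = 'a] by (simp add: card_Diff_singleton)
  finally show ?thesis by (simp add: of_nat_CARD_eq_0)
qed

text \<open>The functional \<open>g \<mapsto> (\<Sum>x. coeff_weight c x * g x)\<close> reads off the coefficient of \<open>x ^ c\<close> of a
  polynomial function of degree below \<open>q\<close>. The naive weight \<open>- x ^ (q - 1 - c)\<close> confuses the exponents
  \<open>0\<close> and \<open>q - 1\<close> when \<open>c = 0\<close>.\<close>

definition coeff_weight :: "nat \<Rightarrow> 'a::{field,finite} \<Rightarrow> 'a" where
  "coeff_weight c x = (if c = 0 then (if x = 0 then 1 else 0) else - (x ^ (CARD('a) - 1 - c)))"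

lemma sum_coeff_weight:
  assumes "e \<le> CARD('a::{field,finite}) - 1" "c \<le> CARD('a) - 1"
  shows "(\<Sum>x\<in>UNIV. coeff_weight c x * (x :: 'a) ^ e) = (if e = c then 1 else 0)"
proof (cases "c = 0")
  case True
  have "(\<Sum>x\<in>UNIV. coeff_weight c x * (x :: 'a) ^ e) = (\<Sum>x\<in>UNIV. if (x :: 'a) = 0 then 0 ^ e else 0)"
    by (intro sum.cong) (auto simp: coeff_weight_def True)
  then show ?thesis using True by (simp add: power_0_left)
next
  case c: False
  have eq: "(\<Sum>x\<in>UNIV. coeff_weight c x * (x :: 'a) ^ e) =
      - (\<Sum>x\<in>UNIV. x ^ (CARD('a) - 1 - c + e))"
    by (simp add: coeff_weight_def c power_add sum_negf)
  consider "e < c" | "e = c" | "e > c" by linarith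
  then show ?thesis
  proof cases
    case 1
    then show ?thesis unfolding eq using assms by (simp add: power_sum_eq_0)
  next
    case 2
    then have "CARD('a) - 1 - c + e = CARD('a) - 1" using assms by simp
    then show ?thesis unfolding eq by (simp only: power_sum_CARD_minus_1) (simp add: 2)
  next
    case 3
    \<comment> \<open>The exponent now exceeds \<open>q - 1\<close>. The surplus factor
      \<open>x ^ (q - 1)\<close> may be dropped even at \<open>x = 0\<close> because
      \<open>e - c > 0\<close>, and \<open>e - c < q - 1\<close> because
      \<open>c > 0\<close>.\<close>
    have "(x :: 'a) ^ (CARD('a) - 1 - c + e) = x ^ (e - c)" for x
    proof -
      have "CARD('a) - 1 - c + e = (CARD('a) - 1) + (e - c)" using 3 assms by simp
      then have "x ^ (CARD('a) - 1 - c + e) = x ^ (CARD('a) - 1) * x ^ (e - c)"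
        by (simp only: power_add)
      also have "\<dots> = x ^ (e - c)" using 3 unfolding field_power_CARD_minus_1_if by simp
      finally show ?thesis .
    qed
    then show ?thesis unfolding eq using 3 c assms by (simp add: power_sum_eq_0)
  qed
qed

subsection \<open>Sums over vectors\<close>

lemma sum_carrier_vec_append:
  "(\<Sum>v\<in>carrier_vec (a + b). F v) = (\<Sum>u\<in>carrier_vec a. \<Sum>w\<in>carrier_vec b. F (u @\<^sub>v w))"
proof -
  have "(\<Sum>v\<in>carrier_vec (a + b). F v) =
      (\<Sum>(u, w)\<in>carrier_vec a \<times> carrier_vec b. F (u @\<^sub>v w))"
    by (rule sum.reindex_bij_witness[of _ "\<lambda>(u, w). u @\<^sub>v w" "\<lambda>v. (vec_first v a, vec_last v b)"])
       (auto simp: vec_first_def vec_last_def intro!: eq_vecI arg_cong[of _ _ F])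
  then show ?thesis by (simp add: sum.cartesian_product)
qed

lemma sum_carrier_vec_1: "(\<Sum>v\<in>carrier_vec 1. F v) = (\<Sum>x\<in>UNIV. F (vec 1 (\<lambda>_. x)))"
  by (rule sum.reindex_bij_witness[of _ "\<lambda>x. vec 1 (\<lambda>_. x)" "\<lambda>v. v $ 0"])
     (auto intro!: eq_vecI arg_cong[of _ _ F])

lemma carrier_vec_0: "carrier_vec 0 = {vNil}"
  by (auto intro!: eq_vecI)

lemma sum_carrier_vec_Suc:
  "(\<Sum>v\<in>carrier_vec (Suc m). F v) = (\<Sum>u\<in>carrier_vec m. \<Sum>x\<in>UNIV. F (u @\<^sub>v vec 1 (\<lambda>_. x)))"
  using sum_carrier_vec_append[of F m 1] by (simp add: sum_carrier_vec_1[simplified])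

lemma sum_carrier_vec_prod:
  fixes g :: "nat \<Rightarrow> 'a::finite \<Rightarrow> 'b::comm_ring_1"
  shows "(\<Sum>v\<in>carrier_vec m. \<Prod>i<m. g i (v $ i)) = (\<Prod>i<m. \<Sum>x\<in>UNIV. g i x)"
proof (induction m)
  case 0
  then show ?case by (simp add: carrier_vec_0)
next
  case (Suc m)
  have "(\<Sum>v\<in>carrier_vec (Suc m). \<Prod>i<Suc m. g i (v $ i)) =
     (\<Sum>u\<in>carrier_vec m. \<Sum>x\<in>UNIV. (\<Prod>i<m. g i (u $ i)) * g m x)"
    unfolding sum_carrier_vec_Suc by (intro sum.cong refl) auto
  also have "\<dots> = (\<Prod>i<Suc m. \<Sum>x\<in>UNIV. g i x)"
    by (simp add: sum_distrib_left[symmetric] sum_distrib_right[symmetric] Suc.IH)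
  finally show ?case .
qed

subsection \<open>Multinomial coefficients and Lucas' theorem\<close>

text \<open>The multinomial coefficient as a product of binomials, splitting off the last part
  first. It is 0 unless the parts add up to \<open>N\<close>; the truncated \<open>N - c m\<close>
  does no harm, since the binomial vanishes when \<open>c m > N\<close>.\<close>

fun multinom :: "nat \<Rightarrow> (nat \<Rightarrow> nat) \<Rightarrow> nat \<Rightarrow> nat" where
  "multinom 0 c N = (if N = 0 then 1 else 0)"
| "multinom (Suc m) c N = (N choose c m) * multinom m c (N - c m)"

lemma multinom_eq_0: "(\<Sum>j<m. c j) \<noteq> N \<Longrightarrow> multinom m c N = 0"
proof (induction m arbitrary: N)
  case (Suc m)
  then show ?case by (cases "c m \<le> N") (auto simp: binomial_eq_0)
qed auto

text \<open>The weights read off the coefficient of the monomial with exponents \<open>c j\<close>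
  in a power of a linear form. The binomial theorem isolates the last variable, whose weight keeps
  only the term \<open>k = c m\<close>; \<open>N\<close> is at most \<open>q - 1\<close>, so all
  exponents are in the range where the weights work.\<close>

lemma sum_coeff_weight_linear_power:
  fixes y :: "nat \<Rightarrow> 'a::{field,finite}"
  assumes "N \<le> CARD('a) - 1" "\<And>j. j < m \<Longrightarrow> c j \<le> CARD('a) - 1"
  shows "(\<Sum>v\<in>carrier_vec m. (\<Prod>j<m. coeff_weight (c j) (v $ j)) * (\<Sum>j<m. v $ j * y j) ^ N) =
     of_nat (multinom m c N) * (\<Prod>j<m. y j ^ c j)"
  using assms
proof (induction m arbitrary: N)
  case 0
  then show ?case by (simp add: carrier_vec_0)
next
  case (Suc m)
  let ?W = "\<lambda>u. \<Prod>j<m. coeff_weight (c j) (u $ j)" and ?L = "\<lambda>u. \<Sum>j<m. u $ j * y j"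
  have "(\<Sum>v\<in>carrier_vec (Suc m). (\<Prod>j<Suc m. coeff_weight (c j) (v $ j)) * (\<Sum>j<Suc m. v $ j * y j) ^ N) =
     (\<Sum>u\<in>carrier_vec m. \<Sum>x\<in>UNIV. ?W u * coeff_weight (c m) x * (x * y m + ?L u) ^ N)"
    unfolding sum_carrier_vec_Suc by (intro sum.cong refl) (auto simp: add.commute)
  also have "\<dots> = (\<Sum>u\<in>carrier_vec m. ?W u *
      (\<Sum>k\<le>N. of_nat (N choose k) * y m ^ k * ?L u ^ (N - k) * (\<Sum>x\<in>UNIV. coeff_weight (c m) x * x ^ k)))"
    unfolding binomial_ring sum_distrib_left
    by (subst sum.swap[of _ "{..N}"]) (simp add: power_mult_distrib ac_simps)
  also have "\<dots> = (\<Sum>u\<in>carrier_vec m. ?W u *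
      (\<Sum>k\<le>N. if k = c m then of_nat (N choose k) * y m ^ k * ?L u ^ (N - k) else 0))"
    by (intro sum.cong refl arg_cong2[where f = "(*)"])
       (use Suc.prems in \<open>auto simp: sum_coeff_weight\<close>)
  also have "\<dots> = (\<Sum>u\<in>carrier_vec m. ?W u * (of_nat (N choose c m) * y m ^ c m * ?L u ^ (N - c m)))"
    by (auto simp: binomial_eq_0 intro!: sum.cong)
  also have "\<dots> = of_nat (N choose c m) * y m ^ c m * (\<Sum>u\<in>carrier_vec m. ?W u * ?L u ^ (N - c m))"
    by (simp add: sum_distrib_left ac_simps)
  also have "\<dots> = of_nat (multinom (Suc m) c N) * (\<Prod>j<Suc m. y j ^ c j)"
    using Suc.prems by (subst Suc.IH) (auto simp: ac_simps)
  finally show ?case .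
qed

section \<open>Lucas' theorem and digitwise addition without carries\<close>

lemma CHAR_poly_eq: "CHAR('a::comm_ring_1 poly) = CHAR('a)"
  by (rule CHAR_eqI) (auto simp: of_nat_poly of_nat_eq_0_iff_char_dvd)

text \<open>One digit of Lucas' theorem: compare coefficients in (1 + X)^(a + p b) = (1 + X)^a (1 +
  X^p)^b, which holds in characteristic \<open>p\<close>.\<close>

lemma lucas_of_nat:
  assumes p: "prime p" "CHAR('a::field) = p" and "a < p" "c < p"
  shows "(of_nat ((a + p * b) choose (c + p * d)) :: 'a) = of_nat (a choose c) * of_nat (b choose d)"
proof -
  let ?X = "monom 1 1 :: 'a poly"
  have coeff_binom: "coeff ((1 + monom 1 e) ^ m) i =
      (if e dvd i then of_nat (m choose (i div e)) else (0::'a))" if "e > 0" for e m i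
  proof -
    have "(1 + monom 1 e :: 'a poly) ^ m = (\<Sum>k\<le>m. monom (of_nat (m choose k)) (e * k))"
      by (subst add.commute, subst binomial_ring)
         (simp add: monom_power of_nat_poly smult_monom mult.commute)
    then have "coeff ((1 + monom 1 e :: 'a poly) ^ m) i =
        (\<Sum>k\<le>m. if e * k = i then of_nat (m choose k) else 0)" by (simp add: coeff_sum)
    also have "\<dots> = (\<Sum>k\<le>m. if e dvd i \<and> k = i div e then of_nat (m choose k) else 0)"
      using that by (intro sum.cong refl) auto
    also have "\<dots> = (if e dvd i then of_nat (m choose (i div e)) else (0::'a))"
      by (auto simp: binomial_eq_0)
    finally show ?thesis .
  qed
  have "p > 0" using p by (simp add: prime_gt_0_nat)
  have "(1 + ?X) ^ p = 1 + monom 1 p"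
    using p by (subst freshmans_dream) (auto simp: CHAR_poly_eq monom_power)
  then have "(1 + ?X) ^ (a + p * b) = (1 + ?X) ^ a * (1 + monom 1 p) ^ b"
    by (simp add: power_add power_mult)
  then have "of_nat ((a + p * b) choose (c + p * d)) =
      coeff ((1 + ?X) ^ a * (1 + monom 1 p) ^ b) (c + p * d)"
    using coeff_binom[of 1 "a + p * b" "c + p * d"] by simp
  also have "\<dots> = (\<Sum>i\<le>c + p * d. of_nat (a choose i) * coeff ((1 + monom 1 p) ^ b) (c + p * d - i))"
    unfolding coeff_mult using coeff_binom[of 1 a] by simp
  \<comment> \<open>For \<open>i > a\<close> the binomial vanishes. For \<open>i \<le> a < p\<close>
    the other factor requires \<open>p\<close> to divide \<open>c + p * d - i\<close>, which forces
    \<open>i = c\<close> since both are below \<open>p\<close>.\<close>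
  also have "\<dots> = (\<Sum>i\<in>{c}. of_nat (a choose i) * coeff ((1 + monom 1 p) ^ b) (c + p * d - i))"
  proof (rule sum.mono_neutral_right)
    show "\<forall>i\<in>{..c + p * d} - {c}. of_nat (a choose i) * coeff ((1 + monom 1 p) ^ b) (c + p * d - i) = (0::'a)"
    proof
      fix i assume i: "i \<in> {..c + p * d} - {c}"
      show "of_nat (a choose i) * coeff ((1 + monom 1 p) ^ b) (c + p * d - i) = (0::'a)"
      proof (cases "i \<le> a")
        case True
        have "\<not> p dvd c + p * d - i"
        proof
          assume "p dvd c + p * d - i"
          then have "(c + p * d) mod p = i mod p"
            using i by (metis DiffD1 atMost_iff mod_eq_dvd_iff_nat)
          then show False using i True assms by simp
        qed
        then show ?thesis using coeff_binom[OF \<open>p > 0\<close>] by simp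
      qed (simp add: binomial_eq_0)
    qed
  qed auto
  also have "\<dots> = of_nat (a choose c) * of_nat (b choose d)"
    using coeff_binom[OF \<open>p > 0\<close>] \<open>p > 0\<close> by simp
  finally show ?thesis .
qed

text \<open>The digits \<open>u l\<close> and \<open>w l\<close> add without carry, so by Lucas the
  binomial is the product of the digit binomials. None of these is divisible by \<open>p\<close>,
  because the factorial of a number below \<open>p\<close> is not.\<close>

lemma of_nat_choose_no_carry:
  assumes p: "prime p" "CHAR('a::field) = p" and "\<And>l. l < k \<Longrightarrow> u l + w l < p"
  shows "(of_nat ((\<Sum>l<k. (u l + w l) * p ^ l) choose (\<Sum>l<k. u l * p ^ l)) :: 'a) \<noteq> 0"
  using assms(3)
proof (induction k arbitrary: u w)
  case 0
  then show ?case by simp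
next
  case (Suc k)
  have shift: "(\<Sum>l<Suc k. g l * p ^ l) = g 0 + p * (\<Sum>l<k. g (Suc l) * p ^ l)" for g
    by (simp add: sum.lessThan_Suc_shift sum_distrib_left ac_simps del: sum.lessThan_Suc)
  have "\<not> p dvd ((u 0 + w 0) choose u 0)"
  proof
    assume "p dvd ((u 0 + w 0) choose u 0)"
    then have "p dvd fact (u 0 + w 0)"
      using binomial_fact_lemma[of "u 0" "u 0 + w 0"] by (metis dvd_mult le_add1)
    then show False using Suc.prems[of 0] p(1) by (simp add: prime_dvd_fact_iff)
  qed
  then have "of_nat ((u 0 + w 0) choose u 0) \<noteq> (0::'a)"
    using p by (simp add: of_nat_eq_0_iff_char_dvd)
  moreover have "(of_nat ((\<Sum>l<k. (u (Suc l) + w (Suc l)) * p ^ l) choose (\<Sum>l<k. u (Suc l) * p ^ l)) :: 'a) \<noteq> 0"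
    using Suc.prems by (intro Suc.IH) auto
  ultimately show ?case unfolding shift
    using Suc.prems[of 0] by (subst lucas_of_nat[OF p]) auto
qed

text \<open>Here \<open>x j l\<close> is digit \<open>l\<close> of \<open>c j\<close>. As each digit
  position sums to less than \<open>p\<close>, no partial sum of the \<open>c j\<close> produces a
  carry, and every binomial factor is nonzero.\<close>

lemma of_nat_multinom_no_carry:
  assumes p: "prime p" "CHAR('a::field) = p"
    and "\<And>l. l < k \<Longrightarrow> (\<Sum>j<m. x j l) < p" "\<And>j. j < m \<Longrightarrow> c j = (\<Sum>l<k. x j l * p ^ l)"
  shows "(of_nat (multinom m c (\<Sum>j<m. c j)) :: 'a) \<noteq> 0"
  using assms(3,4)
proof (induction m)
  case 0
  then show ?case by simp
next
  case (Suc m)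
  have "(\<Sum>j<m. c j) = (\<Sum>l<k. (\<Sum>j<m. x j l) * p ^ l)"
    using Suc.prems(2) by (subst sum_distrib_right, subst sum.swap) simp
  then have "(\<Sum>j<Suc m. c j) = (\<Sum>l<k. (x m l + (\<Sum>j<m. x j l)) * p ^ l)"
    using Suc.prems(2)[of m] by (simp add: sum.distrib algebra_simps)
  moreover have "(of_nat ((\<Sum>l<k. (x m l + (\<Sum>j<m. x j l)) * p ^ l) choose (\<Sum>l<k. x m l * p ^ l)) :: 'a) \<noteq> 0"
    using Suc.prems(1) by (intro of_nat_choose_no_carry p) (simp add: add.commute)
  ultimately have "of_nat ((\<Sum>j<Suc m. c j) choose c m) \<noteq> (0::'a)"
    using Suc.prems(2)[of m] by simp
  moreover have "(of_nat (multinom m c (\<Sum>j<m. c j)) :: 'a) \<noteq> 0"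
    using Suc.prems by (intro Suc.IH) (auto simp: less_Suc_eq intro: add_lessD1)
  ultimately show ?case by simp
qed

subsection \<open>Filling bins with powers of a prime\<close>

text \<open>Take an element of largest value first. All other values divide that value as well as
  \<open>B\<close>, so they divide the remaining target and the argument repeats.\<close>

lemma subset_sum_divisor_chain:
  fixes v :: "'b \<Rightarrow> nat"
  assumes "finite X" "\<And>x. x \<in> X \<Longrightarrow> v x > 0"
    and "\<And>x y. x \<in> X \<Longrightarrow> y \<in> X \<Longrightarrow> v x dvd v y \<or> v y dvd v x"
    and "\<And>x. x \<in> X \<Longrightarrow> v x dvd B" "B \<le> sum v X"
  shows "\<exists>Y\<subseteq>X. sum v Y = B"
  using assms
proof (induction X arbitrary: B rule: finite_psubset_induct)
  case (psubset X)
  show ?case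
  proof (cases "B = 0")
    case True
    then show ?thesis by (intro exI[of _ "{}"]) simp
  next
    case False
    then have "X \<noteq> {}" using psubset.prems(4) by auto
    then have "Max (v ` X) \<in> v ` X" using psubset.hyps by (intro Max_in) auto
    then obtain x where x: "x \<in> X" "Max (v ` X) = v x" by auto
    have max: "v y \<le> v x" if "y \<in> X" for y
      using that psubset.hyps x(2) by (metis Max_ge finite_imageI imageI)
    have dvd: "v y dvd v x" if "y \<in> X" for y
      using psubset.prems(1,2) x(1) that max[OF that]
      by (metis dvd_imp_le dvd_refl le_antisym)
    have "v x \<le> B" using psubset.prems(3)[OF x(1)] False by (simp add: dvd_imp_le)
    have "\<exists>Y\<subseteq>X - {x}. sum v Y = B - v x"
    proof (rule psubset.IH)
      show "X - {x} \<subset> X" using x by blast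
      show "B - v x \<le> sum v (X - {x})"
        using psubset.prems(4) psubset.hyps x(1) by (simp add: sum.remove[of X x])
    qed (use psubset.prems dvd x in \<open>auto intro!: dvd_diff_nat\<close>)
    then obtain Y where Y: "Y \<subseteq> X - {x}" "sum v Y = B - v x" by blast
    have "finite Y" "x \<notin> Y" using Y(1) psubset.hyps finite_subset by blast+
    then have "sum v (insert x Y) = B" using Y(2) \<open>v x \<le> B\<close> by simp
    then show ?thesis using Y(1) x(1) by (intro exI[of _ "insert x Y"]) auto
  qed
qed

text \<open>By truncated subtraction, \<open>R - j * Q\<close> is the supply left after
  \<open>j\<close> full bins and is 0 once the supply is exhausted.\<close>

lemma sum_greedy_loads: "(\<Sum>j<m. min Q (R - j * Q)) = min (m * Q) (R :: nat)"
  by (induction m) (auto simp: min_def)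

text \<open>The label \<open>m\<close> marks elements not yet placed, which is why loads are
  prescribed only for \<open>j < m\<close>. The next bin takes a subset of value exactly
  \<open>Q\<close> from the unplaced elements, or all of them if less than \<open>Q\<close> is
  left.\<close>

lemma greedy_filling:
  fixes v :: "'b \<Rightarrow> nat"
  assumes "finite X" "\<And>x. x \<in> X \<Longrightarrow> v x > 0"
    and "\<And>x y. x \<in> X \<Longrightarrow> y \<in> X \<Longrightarrow> v x dvd v y \<or> v y dvd v x"
    and "\<And>x. x \<in> X \<Longrightarrow> v x dvd Q"
  shows "\<exists>\<beta>. (\<forall>x\<in>X. \<beta> x \<le> m) \<and> (\<forall>j<m. sum v {x \<in> X. \<beta> x = j} = min Q (sum v X - j * Q))"
proof (induction m)
  case 0
  then show ?case by (intro exI[of _ "\<lambda>_. 0"]) simp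
next
  case (Suc m)
  then obtain \<beta> where \<beta>: "\<And>x. x \<in> X \<Longrightarrow> \<beta> x \<le> m"
    "\<And>j. j < m \<Longrightarrow> sum v {x \<in> X. \<beta> x = j} = min Q (sum v X - j * Q)" by blast
  let ?R = "{x \<in> X. \<beta> x = m}"
  have "sum v X = (\<Sum>j<Suc m. sum v {x \<in> X. \<beta> x = j})"
    using assms(1) \<beta>(1) by (intro sum.group[symmetric]) (auto simp: less_Suc_eq_le)
  also have "\<dots> = min (m * Q) (sum v X) + sum v ?R"
    using \<beta>(2) by (simp add: sum_greedy_loads)
  finally have R: "sum v ?R = sum v X - m * Q" by linarith
  have "\<exists>Y\<subseteq>?R. sum v Y = min Q (sum v X - m * Q)"
  proof (cases "Q \<le> sum v X - m * Q")
    case True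
    then show ?thesis
      using assms R by (subst min_absorb1, simp, intro subset_sum_divisor_chain) auto
  next
    case False
    then show ?thesis using R by (intro exI[of _ ?R]) auto
  qed
  then obtain Y where Y: "Y \<subseteq> ?R" "sum v Y = min Q (sum v X - m * Q)" by blast
  \<comment> \<open>The chosen elements keep the label \<open>m\<close>; the others move on to the
    new overflow label \<open>Suc m\<close>.\<close>
  define \<beta>' where "\<beta>' x = (if x \<in> ?R - Y then Suc m else \<beta> x)" for x
  have "{x \<in> X. \<beta>' x = j} = (if j = m then Y else {x \<in> X. \<beta> x = j})" if "j < Suc m" for j
    using that Y(1) unfolding \<beta>'_def by auto
  then have "\<forall>j<Suc m. sum v {x \<in> X. \<beta>' x = j} = min Q (sum v X - j * Q)"
    using Y(2) \<beta>(2) by simp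
  moreover have "\<forall>x\<in>X. \<beta>' x \<le> Suc m" unfolding \<beta>'_def using \<beta>(1) by (simp add: le_SucI)
  ultimately show ?case by blast
qed

section \<open>Base-\<open>p\<close> digits and the splitting of exponents\<close>

lemma mod_power_eq_sum_digits: "a mod p ^ k = (\<Sum>l<k. (a div p ^ l mod p) * p ^ l)" for a p :: nat
proof (induction k)
  case (Suc k)
  have "a mod p ^ Suc k = p ^ k * (a div p ^ k mod p) + a mod p ^ k"
    by (metis mod_mult2_eq mult.commute power_Suc)
  then show ?case using Suc.IH by simp
qed simp

text \<open>The extra index \<open>M\<close> collects what does not fit into the first
  \<open>M\<close> bins; it later belongs to the translation part of the affine map. The tokens of
  one digit are distributed without being broken, so the digits of the \<open>c i j\<close> add up
  to those of \<open>a i\<close> without carries.\<close>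

lemma exponent_splitting:
  fixes a :: "nat \<Rightarrow> nat"
  assumes p: "prime p" "CHAR('a::field) = p"
    and a: "\<And>i. i < n \<Longrightarrow> a i < p ^ k" and Q: "\<And>l. l < k \<Longrightarrow> p ^ l dvd Q"
  shows "\<exists>c. (\<forall>i<n. (\<Sum>j<Suc M. c i j) = a i) \<and>
     (\<forall>i<n. (of_nat (multinom (Suc M) (c i) (a i)) :: 'a) \<noteq> 0) \<and>
     (\<forall>j<M. (\<Sum>i<n. c i j) = min Q ((\<Sum>i<n. a i) - j * Q))"
proof -
  define dig where "dig i l = a i div p ^ l mod p" for i l
  have "p > 0" using p(1) by (simp add: prime_gt_0_nat)
  have dig_less: "dig i l < p" for i l using \<open>p > 0\<close> by (simp add: dig_def)
  have a_dig: "a i = (\<Sum>l<k. dig i l * p ^ l)" if "i < n" for i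
    using mod_power_eq_sum_digits[of "a i" p k] a[OF that] by (simp add: dig_def)
  \<comment> \<open>The token \<open>(i, l, u)\<close> is the \<open>u\<close>-th unit of digit
    \<open>l\<close> of \<open>a i\<close>, and it has value \<open>p ^ l\<close>.\<close>
  define X where "X = (SIGMA i:{..<n}. SIGMA l:{..<k}. {..<dig i l})"
  define v where "v = (\<lambda>(i::nat, l::nat, u::nat). p ^ l)"
  have "finite X" unfolding X_def by auto
  have sumX: "sum v X = (\<Sum>i<n. a i)"
    unfolding X_def v_def by (simp add: sum.Sigma[symmetric] a_dig)
  obtain \<beta> where \<beta>: "\<And>x. x \<in> X \<Longrightarrow> \<beta> x \<le> M"
      "\<And>j. j < M \<Longrightarrow> sum v {x \<in> X. \<beta> x = j} = min Q (sum v X - j * Q)"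
  proof -
    have "\<exists>\<beta>. (\<forall>x\<in>X. \<beta> x \<le> M) \<and> (\<forall>j<M. sum v {x \<in> X. \<beta> x = j} = min Q (sum v X - j * Q))"
    proof (rule greedy_filling[OF \<open>finite X\<close>])
      show "v x dvd v y \<or> v y dvd v x" for x y
        unfolding v_def by (simp split: prod.split) (meson le_imp_power_dvd nat_le_linear)
    qed (use Q \<open>p > 0\<close> in \<open>auto simp: v_def X_def\<close>)
    then show ?thesis using that by blast
  qed
  \<comment> \<open>The number of tokens of digit \<open>l\<close> of \<open>a i\<close> put into
    bin \<open>j\<close> is digit \<open>l\<close> of \<open>c i j\<close>.\<close>
  define x where "x i j l = card {u \<in> {..<dig i l}. \<beta> (i, l, u) = j}" for i j l
  define c where "c i j = (\<Sum>l<k. x i j l * p ^ l)" for i j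
  have x_sum: "(\<Sum>j<Suc M. x i j l) = dig i l" if "i < n" "l < k" for i l
  proof -
    have "(\<Sum>j<Suc M. x i j l) = (\<Sum>j<Suc M. \<Sum>u\<in>{u \<in> {..<dig i l}. \<beta> (i, l, u) = j}. 1)"
      by (simp add: x_def)
    also have "\<dots> = (\<Sum>u<dig i l. 1)"
      using that \<beta>(1) by (intro sum.group) (auto simp: X_def less_Suc_eq_le)
    finally show ?thesis by simp
  qed
  have c_sum: "(\<Sum>j<Suc M. c i j) = a i" if "i < n" for i
  proof -
    have "(\<Sum>j<Suc M. c i j) = (\<Sum>l<k. (\<Sum>j<Suc M. x i j l) * p ^ l)"
      unfolding c_def sum_distrib_right by (rule sum.swap)
    then show ?thesis using that by (simp add: x_sum a_dig del: sum.lessThan_Suc)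
  qed
  moreover have "(of_nat (multinom (Suc M) (c i) (a i)) :: 'a) \<noteq> 0" if "i < n" for i
    unfolding c_sum[OF that, symmetric]
    by (rule of_nat_multinom_no_carry[OF p, where k = k and x = "x i"])
       (use that dig_less x_sum c_def in \<open>auto simp del: sum.lessThan_Suc\<close>)
  moreover have "(\<Sum>i<n. c i j) = min Q ((\<Sum>i<n. a i) - j * Q)" if "j < M" for j
  proof -
    have "{x \<in> X. \<beta> x = j} = (SIGMA i:{..<n}. SIGMA l:{..<k}. {u \<in> {..<dig i l}. \<beta> (i, l, u) = j})"
      unfolding X_def by auto
    then have "sum v {x \<in> X. \<beta> x = j} = (\<Sum>i<n. c i j)"
      unfolding v_def c_def x_def by (simp add: sum.Sigma[symmetric])
    then show ?thesis using \<beta>(2)[OF that] sumX by simp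
  qed
  ultimately show ?thesis by blast
qed

subsection \<open>Evaluation and degree of multivariate polynomials\<close>

lemma mpoly_eq_sum_single: "F = (\<Sum>m\<in>Poly_Mapping.keys F. Poly_Mapping.single m (Poly_Mapping.lookup F m))"
  by (rule poly_mapping_eqI) (auto simp: lookup_sum lookup_single when_def in_keys_iff)

lemma eval_monom_superset:
  assumes "finite S" "Poly_Mapping.keys m \<subseteq> S"
  shows "eval_monom x m = (\<Prod>i\<in>S. x i ^ Poly_Mapping.lookup m i)"
  unfolding eval_monom_def using assms
  by (intro prod.mono_neutral_left) (auto simp: in_keys_iff)

lemma eval_monom_add: "eval_monom x (a + b) = eval_monom x a * eval_monom x b"
proof -
  let ?S = "Poly_Mapping.keys a \<union> Poly_Mapping.keys b"
  have "Poly_Mapping.keys (a + b) \<subseteq> ?S" by (rule Poly_Mapping.keys_add)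
  then show ?thesis
    by (simp add: eval_monom_superset[of ?S] lookup_add power_add prod.distrib)
qed

lemma eval_mpoly_mult: "eval_mpoly x (F * G) = eval_mpoly x F * eval_mpoly x G"
proof -
  have "F * G = (\<Sum>a\<in>Poly_Mapping.keys F. \<Sum>b\<in>Poly_Mapping.keys G.
      Poly_Mapping.single (a + b) (Poly_Mapping.lookup F a * Poly_Mapping.lookup G b))"
    by (subst mpoly_eq_sum_single[of F], subst mpoly_eq_sum_single[of G])
       (simp add: sum_product mult_single)
  then show ?thesis
    by (simp add: eval_mpoly_sum eval_mpoly_single eval_monom_add)
       (simp add: eval_mpoly_def sum_product ac_simps)
qed

lemma eval_mpoly_1 [simp]: "eval_mpoly x 1 = 1"
  using eval_mpoly_single[of x 0 1] by (simp add: eval_monom_def)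

lemma eval_mpoly_uminus: "eval_mpoly x (- F) = - eval_mpoly x F"
  using eval_mpoly_add[of x F "- F"] by (simp add: add_eq_0_iff)

lemma eval_mpoly_power: "eval_mpoly x (F ^ k) = eval_mpoly x F ^ k"
  by (induction k) (auto simp: eval_mpoly_mult)

lemma eval_mpoly_prod: "eval_mpoly x (\<Prod>i\<in>A. F i) = (\<Prod>i\<in>A. eval_mpoly x (F i))"
  by (induction A rule: infinite_finite_induct) (auto simp: eval_mpoly_mult)

lemma eval_mpoly_Var: "eval_mpoly x (Var i) = x i"
  by (simp add: Var_def eval_mpoly_single eval_monom_def)

lemma monom_degree_superset:
  assumes "finite S" "Poly_Mapping.keys m \<subseteq> S"
  shows "monom_degree m = (\<Sum>i\<in>S. Poly_Mapping.lookup m i)"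
  unfolding monom_degree_def using assms
  by (intro sum.mono_neutral_left) (auto simp: in_keys_iff)

lemma monom_degree_add: "monom_degree (a + b) = monom_degree a + monom_degree b"
proof -
  let ?S = "Poly_Mapping.keys a \<union> Poly_Mapping.keys b"
  have "Poly_Mapping.keys (a + b) \<subseteq> ?S" by (rule Poly_Mapping.keys_add)
  then show ?thesis
    by (simp add: monom_degree_superset[of ?S] lookup_add sum.distrib)
qed

lemma keys_add_nat: "Poly_Mapping.keys (a + b) = Poly_Mapping.keys a \<union> Poly_Mapping.keys b"
  for a b :: "nat \<Rightarrow>\<^sub>0 nat"
  by (auto simp: in_keys_iff lookup_add)

section \<open>Bounds on the degree and the variables of a polynomial\<close>

lemma total_degree_le_iff: "total_degree F \<le> D \<longleftrightarrow> (\<forall>m\<in>Poly_Mapping.keys F. monom_degree m \<le> D)"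
  unfolding total_degree_def by simp

definition mpoly_bounded :: "nat set \<Rightarrow> nat \<Rightarrow> 'a::zero mpoly \<Rightarrow> bool" where
  "mpoly_bounded V D F \<longleftrightarrow>
     (\<forall>m\<in>Poly_Mapping.keys F. Poly_Mapping.keys m \<subseteq> V \<and> monom_degree m \<le> D)"

lemma mpoly_bounded_add:
  "mpoly_bounded V D F \<Longrightarrow> mpoly_bounded V D G \<Longrightarrow> mpoly_bounded V D (F + G)"
  unfolding mpoly_bounded_def using Poly_Mapping.keys_add[of F G] by blast

lemma mpoly_bounded_sum:
  "(\<And>i. i \<in> A \<Longrightarrow> mpoly_bounded V D (F i)) \<Longrightarrow> mpoly_bounded V D (\<Sum>i\<in>A. F i)"
  using Poly_Mapping.keys_sum[of F A] unfolding mpoly_bounded_def by blast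

lemma mpoly_bounded_mult:
  "mpoly_bounded V D F \<Longrightarrow> mpoly_bounded V E G \<Longrightarrow> mpoly_bounded V (D + E) (F * G)"
  unfolding mpoly_bounded_def
  by (auto dest!: subsetD[OF Poly_Mapping.keys_mult] simp: monom_degree_add keys_add_nat add_mono) blast+

lemma mpoly_bounded_1: "mpoly_bounded V 0 (1 :: 'a::comm_ring_1 mpoly)"
  unfolding mpoly_bounded_def by (simp add: monom_degree_def)

lemma mpoly_bounded_uminus: "mpoly_bounded V D F \<Longrightarrow> mpoly_bounded V D (- F :: 'a::comm_ring_1 mpoly)"
  unfolding mpoly_bounded_def by (simp add: in_keys_iff)

lemma mpoly_bounded_power:
  fixes F :: "'a::comm_ring_1 mpoly"
  shows "mpoly_bounded V D F \<Longrightarrow> mpoly_bounded V (k * D) (F ^ k)"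
  by (induction k) (auto simp: mpoly_bounded_1 mpoly_bounded_mult)

lemma mpoly_bounded_Var: "i \<in> V \<Longrightarrow> mpoly_bounded V 1 (Var i)"
  unfolding mpoly_bounded_def Var_def by (auto simp: monom_degree_def)

lemma eval_mpoly_cong:
  assumes "mpoly_bounded V D F" "\<And>i. i \<in> V \<Longrightarrow> x i = y i"
  shows "eval_mpoly x F = eval_mpoly y F"
  using assms unfolding eval_mpoly_def eval_monom_def mpoly_bounded_def
  by (intro sum.cong refl arg_cong2[where f = "(*)"] prod.cong) (auto simp: subset_iff)

lemma prod_Var_eq_single:
  "(\<Prod>i<n. Var i) = Poly_Mapping.single (\<Sum>i<n. Poly_Mapping.single i 1) (1 :: 'a::comm_ring_1)"
  by (induction n) (auto simp: Var_def mult_single)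

text \<open>Adding \<open>b\<close> to exponents is injective, so exactly one term can contribute.
  This makes the coefficients of a quotient by a monomial visible in the dividend.\<close>

lemma lookup_mult_single:
  fixes F :: "'a::comm_ring_1 mpoly"
  shows "Poly_Mapping.lookup (F * Poly_Mapping.single b c) (a + b) = Poly_Mapping.lookup F a * c"
proof -
  have "F * Poly_Mapping.single b c =
      (\<Sum>m\<in>Poly_Mapping.keys F. Poly_Mapping.single (m + b) (Poly_Mapping.lookup F m * c))"
    by (subst mpoly_eq_sum_single[of F]) (simp add: sum_distrib_right mult_single)
  then show ?thesis
    by (auto simp: lookup_sum lookup_single when_def in_keys_iff)
qed

lemma sparse_P_num_bounded:
  assumes "p > 0"
  shows "mpoly_bounded {..<p} (CARD('a) - 1) (sparse_P_num p :: 'a::{field,finite} mpoly)"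
proof -
  have "mpoly_bounded {..<p} (0 + (CARD('a) - 1) * 1)
     ((-1) ^ (card I + 1) * ((\<Sum>i\<in>I. Var i) + Var (p - 1)) ^ (CARD('a) - 1) :: 'a mpoly)"
    if "I \<subseteq> {..<p - 1}" for I
  proof (intro mpoly_bounded_mult mpoly_bounded_power mpoly_bounded_add mpoly_bounded_sum mpoly_bounded_Var)
    show "mpoly_bounded {..<p} 0 ((-1) ^ (card I + 1) :: 'a mpoly)"
      using mpoly_bounded_power[of "{..<p}" 0 "-1 :: 'a mpoly" "card I + 1"]
      by (simp only: mult_0_right mpoly_bounded_uminus mpoly_bounded_1)
  qed (use that assms in auto)
  then show ?thesis unfolding sparse_P_num_def by (intro mpoly_bounded_sum) auto
qed

text \<open>The divisor is a monomial of degree \<open>p - 1\<close>, so each monomial of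
  \<open>sparse_P\<close> appears, shifted by that degree, in the numerator of degree at most
  \<open>q - 1\<close>.\<close>

lemma sparse_P_bounded:
  assumes "p > 0"
  shows "mpoly_bounded {..<p} (CARD('a) - p) (sparse_P p :: 'a::{field,finite} mpoly)"
  unfolding mpoly_bounded_def
proof
  fix m assume m: "m \<in> Poly_Mapping.keys (sparse_P p :: 'a mpoly)"
  let ?b = "\<Sum>i<p - 1. Poly_Mapping.single i 1 :: nat \<Rightarrow>\<^sub>0 nat"
  have "Poly_Mapping.lookup (sparse_P_num p :: 'a mpoly) (m + ?b) = Poly_Mapping.lookup (sparse_P p) m"
    unfolding sparse_P[symmetric] prod_Var_eq_single lookup_mult_single by simp
  then have "m + ?b \<in> Poly_Mapping.keys (sparse_P_num p :: 'a mpoly)"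
    using m by (simp add: in_keys_iff)
  then have "Poly_Mapping.keys (m + ?b) \<subseteq> {..<p}" "monom_degree (m + ?b) \<le> CARD('a) - 1"
    using sparse_P_num_bounded[OF assms, where 'a = 'a] unfolding mpoly_bounded_def by blast+
  moreover have "monom_degree ?b = p - 1"
    by (subst monom_degree_superset[of "{..<p - 1}"])
       (auto simp: in_keys_iff lookup_sum_single[where e = "\<lambda>_. 1"] simp del: One_nat_def split: if_splits)
  ultimately show "Poly_Mapping.keys m \<subseteq> {..<p} \<and> monom_degree m \<le> CARD('a) - p"
    using assms by (auto simp: monom_degree_add keys_add_nat)
qed

subsection \<open>Polynomial functions of bounded degree\<close>

text \<open>The bound concerns some representing polynomial, whose exponents need not be reduced.
  Degree bounds for compositions and products thus follow from closure rules.\<close>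

inductive poly_fun :: "nat \<Rightarrow> nat \<Rightarrow> ('a vec \<Rightarrow> 'a::{field,finite}) \<Rightarrow> bool" for M D where
  monom: "(\<Sum>i<M. e i) \<le> D \<Longrightarrow> poly_fun M D (\<lambda>v. c * (\<Prod>i<M. v $ i ^ e i))"
| add: "poly_fun M D g \<Longrightarrow> poly_fun M D h \<Longrightarrow> poly_fun M D (\<lambda>v. g v + h v)"

text \<open>A monomial of degree below \<open>M * (q - 1)\<close> has some exponent below
  \<open>q - 1\<close>, and the power sum of that coordinate vanishes.\<close>

lemma poly_fun_sum_eq_0:
  assumes "poly_fun M D g" "D < M * (CARD('a) - 1)"
  shows "(\<Sum>v\<in>carrier_vec M. g v :: 'a::{field,finite}) = 0"
  using assms
proof (induction rule: poly_fun.induct)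
  case (monom e c)
  have "\<exists>i<M. e i < CARD('a) - 1"
  proof (rule ccontr)
    assume "\<not> ?thesis"
    then have "(\<Sum>i<M. CARD('a) - 1) \<le> (\<Sum>i<M. e i)" by (intro sum_mono) (meson lessThan_iff not_less)
    then show False using monom by simp
  qed
  then have "(\<Prod>i<M. \<Sum>x\<in>UNIV. (x :: 'a) ^ e i) = 0"
    using power_sum_eq_0 by (subst prod_zero_iff) auto
  then have "c * (\<Sum>v\<in>carrier_vec M. \<Prod>i<M. (v $ i :: 'a) ^ e i) = 0"
    by (subst sum_carrier_vec_prod[where g = "\<lambda>i x. x ^ e i"]) simp
  then show ?case by (simp add: sum_distrib_left)
qed (simp add: sum.distrib)

lemma poly_fun_mono: "poly_fun M D g \<Longrightarrow> D \<le> E \<Longrightarrow> poly_fun M E g"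
  by (induction rule: poly_fun.induct) (auto intro: poly_fun.intros)

lemma poly_fun_const: "poly_fun M D (\<lambda>_. c)"
  using poly_fun.monom[of "\<lambda>_. 0" M D c] by simp

lemma poly_fun_coord:
  assumes "i < M"
  shows "poly_fun M 1 (\<lambda>v :: 'a::{field,finite} vec. v $ i)"
proof -
  have eq: "(\<lambda>v. 1 * (\<Prod>j<M. v $ j ^ (if j = i then 1 else 0))) = (\<lambda>v :: 'a vec. v $ i)"
  proof
    fix v :: "'a vec"
    have "(\<Prod>j<M. v $ j ^ (if j = i then 1 else 0)) = (\<Prod>j<M. if j = i then v $ j else 1)"
      by (intro prod.cong) auto
    then show "1 * (\<Prod>j<M. v $ j ^ (if j = i then 1 else 0)) = v $ i" using assms by simp
  qed
  show ?thesis unfolding eq[symmetric] by (rule poly_fun.monom) (use assms in simp)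
qed

lemma poly_fun_mult:
  assumes "poly_fun M D g" "poly_fun M E h"
  shows "poly_fun M (D + E) (\<lambda>v. g v * h v)"
  using assms(1)
proof (induction rule: poly_fun.induct)
  case (monom e c)
  note e = monom
  show ?case using assms(2)
  proof (induction rule: poly_fun.induct)
    case (monom e' c')
    have "poly_fun M (D + E) (\<lambda>v. (c * c') * (\<Prod>i<M. v $ i ^ (e i + e' i)))"
      using e monom by (intro poly_fun.monom) (simp add: sum.distrib)
    then show ?case by (simp add: power_add prod.distrib ac_simps)
  qed (simp add: distrib_left poly_fun.add)
qed (simp add: distrib_right poly_fun.add)

lemma poly_fun_sum:
  "(\<And>i. i \<in> A \<Longrightarrow> poly_fun M D (g i)) \<Longrightarrow> poly_fun M D (\<lambda>v. \<Sum>i\<in>A. g i v)"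
  by (induction A rule: infinite_finite_induct) (auto intro: poly_fun_const poly_fun.add)

lemma poly_fun_prod:
  "(\<And>i. i \<in> A \<Longrightarrow> poly_fun M (D i) (g i)) \<Longrightarrow> poly_fun M (\<Sum>i\<in>A. D i) (\<lambda>v. \<Prod>i\<in>A. g i v)"
  by (induction A rule: infinite_finite_induct) (auto intro: poly_fun_const poly_fun_mult)

lemma poly_fun_power: "poly_fun M D g \<Longrightarrow> poly_fun M (k * D) (\<lambda>v. g v ^ k)"
  by (induction k) (auto intro: poly_fun_const poly_fun_mult)

lemma poly_fun_eval_mpoly:
  assumes F: "mpoly_bounded V D F" and g: "\<And>j. j \<in> V \<Longrightarrow> poly_fun M 1 (g j)"
  shows "poly_fun M D (\<lambda>v. eval_mpoly (\<lambda>j. g j v) F)"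
  unfolding eval_mpoly_def eval_monom_def
proof (rule poly_fun_sum)
  fix m assume m: "m \<in> Poly_Mapping.keys F"
  have "poly_fun M (0 + (\<Sum>i\<in>Poly_Mapping.keys m. Poly_Mapping.lookup m i * 1))
     (\<lambda>v. Poly_Mapping.lookup F m * (\<Prod>i\<in>Poly_Mapping.keys m. g i v ^ Poly_Mapping.lookup m i))"
    using F m g unfolding mpoly_bounded_def
    by (intro poly_fun_mult poly_fun_const poly_fun_prod poly_fun_power) blast
  then show "poly_fun M D
     (\<lambda>v. Poly_Mapping.lookup F m * (\<Prod>i\<in>Poly_Mapping.keys m. g i v ^ Poly_Mapping.lookup m i))"
    using F m unfolding mpoly_bounded_def by (auto simp: monom_degree_def elim!: poly_fun_mono)
qed

subsection \<open>Inner products with the test functions\<close>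

text \<open>The factor \<open>(S + x) ^ (q - 1)\<close> is the indicator of \<open>x\<close> being
  different from \<open>- S\<close>, so exactly one term is missing from the power sum.\<close>

lemma sum_power_times_shifted_power:
  fixes S :: "'a::{field,finite}"
  shows "(\<Sum>x\<in>UNIV. x ^ Q * (S + x) ^ (CARD('a) - 1)) = (\<Sum>x\<in>UNIV. x ^ Q) - (- S) ^ Q"
proof -
  have "x ^ Q * (S + x) ^ (CARD('a) - 1) = x ^ Q - (if x = - S then x ^ Q else 0)" for x
    unfolding field_power_CARD_minus_1_if by (auto simp: add_eq_0_iff2)
  then show ?thesis by (simp only: sum_subtractf) simp
qed

text \<open>Summing over the last coordinate turns each term of the numerator into the power
  \<open>Q\<close> of a partial sum of the other coordinates, up to sign and a constant. The
  remaining sum extracts the coefficient in which each of the \<open>p - 1\<close> variables has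
  exponent \<open>q / p\<close>; only the full index set has such a term.\<close>

lemma sum_sparse_P_nonzero:
  assumes p: "prime p" and card: "CARD('a::{field,finite}) = p ^ k"
    and Q: "Q = CARD('a) - CARD('a) div p"
  shows "(\<Sum>v\<in>carrier_vec p. (\<Prod>j<p. (v $ j) ^ Q) * eval_mpoly (($) v) (sparse_P p :: 'a mpoly)) \<noteq> 0"
proof -
  obtain p' where p': "p = Suc p'" "p' > 0"
    using prime_gt_1_nat[OF p] by (cases p) auto
  have "k \<noteq> 0" using CARD_field_gt_1[where 'a = 'a] card by (intro notI) simp
  then obtain k' where k: "k = Suc k'" by (cases k) auto
  define c where "c = p ^ k'"
  have c: "c > 0" "CARD('a) = p * c" using p' card k by (auto simp: c_def)
  have "CARD('a) div p = c" unfolding c(2) p'(1) by (rule nonzero_mult_div_cancel_left) simp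
  then have Qc: "Q = p' * c" unfolding Q c(2) using p' by simp
  have Q0: "Q > 0" using Qc c p' by simp
  \<comment> \<open>These relations identify \<open>x ^ (Q - 1)\<close> with
    \<open>- coeff_weight c x\<close>.\<close>
  have qc: "c \<le> CARD('a) - 1" "CARD('a) - 1 - c = Q - 1" "Q \<le> CARD('a) - 1" "Q - 1 < CARD('a) - 1"
  proof -
    have "c \<le> p' * c" "CARD('a) = c + p' * c" using p' c by simp_all
    then show "c \<le> CARD('a) - 1" "CARD('a) - 1 - c = Q - 1" "Q \<le> CARD('a) - 1" "Q - 1 < CARD('a) - 1"
      using c(1) unfolding Qc by linarith+
  qed
  let ?S = "\<lambda>I (u :: 'a vec). \<Sum>i\<in>I. u $ i"
  let ?\<sigma> = "\<lambda>I :: nat set. (-1 :: 'a) ^ (card I + 1)"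
  let ?g = "\<lambda>u :: 'a vec. \<Prod>j<p'. (u $ j) ^ (Q - 1)"
  have eval_num: "eval_mpoly x (sparse_P_num p :: 'a mpoly) =
      (\<Sum>I\<in>Pow {..<p'}. ?\<sigma> I * ((\<Sum>i\<in>I. x i) + x p') ^ (CARD('a) - 1))" for x
    unfolding sparse_P_num_def
    by (simp add: eval_mpoly_sum eval_mpoly_mult eval_mpoly_power eval_mpoly_add eval_mpoly_uminus
        eval_mpoly_Var p')
  \<comment> \<open>One factor of each of the first \<open>p - 1\<close> coordinates is spent on the
    denominator, which is possible because \<open>Q > 0\<close>.\<close>
  have "(\<Prod>j<p. (v $ j) ^ Q) * eval_mpoly (($) v) (sparse_P p) =
      ?g v * (v $ p') ^ Q * eval_mpoly (($) v) (sparse_P_num p)" for v :: "'a vec"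
  proof -
    have "(\<Prod>j<p. (v $ j) ^ Q) = (\<Prod>j<p'. (v $ j) ^ (Q - 1) * v $ j) * (v $ p') ^ Q"
      using Q0 by (simp add: p' power_Suc2[symmetric] del: power_Suc)
    also have "(\<Prod>j<p'. (v $ j) ^ (Q - 1) * v $ j) = ?g v * (\<Prod>j<p'. v $ j)"
      by (simp add: prod.distrib)
    finally have "(\<Prod>j<p. (v $ j) ^ Q) = ?g v * (\<Prod>j<p'. v $ j) * (v $ p') ^ Q" .
    moreover have "eval_mpoly (($) v) (sparse_P_num p) = eval_mpoly (($) v) (sparse_P p) * (\<Prod>j<p'. v $ j)"
      unfolding sparse_P[symmetric] by (simp add: eval_mpoly_mult eval_mpoly_prod eval_mpoly_Var p')
    ultimately show ?thesis by (simp only: ac_simps)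
  qed
  then have "(\<Sum>v\<in>carrier_vec p. (\<Prod>j<p. (v $ j) ^ Q) * eval_mpoly (($) v) (sparse_P p :: 'a mpoly)) =
      (\<Sum>v\<in>carrier_vec (Suc p'). ?g v * (v $ p') ^ Q *
         (\<Sum>I\<in>Pow {..<p'}. ?\<sigma> I * (?S I v + v $ p') ^ (CARD('a) - 1)))"
    by (simp only: eval_num p'(1)[symmetric])
  also have "\<dots> = (\<Sum>u\<in>carrier_vec p'. \<Sum>x\<in>UNIV. ?g u * x ^ Q *
         (\<Sum>I\<in>Pow {..<p'}. ?\<sigma> I * (?S I u + x) ^ (CARD('a) - 1)))"
    unfolding sum_carrier_vec_Suc
  proof (intro sum.cong refl arg_cong2[where f = "(*)"] arg_cong2[where f = "(^)"]
      arg_cong2[where f = "(+)"] prod.cong)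
    fix u :: "'a vec" and x I i
    assume "u \<in> carrier_vec p'" "I \<in> Pow {..<p'}" "i \<in> I"
    then show "(u @\<^sub>v vec 1 (\<lambda>_. x)) $ i = u $ i" by (subst index_append_vec) auto
  qed auto
  also have "\<dots> = (\<Sum>u\<in>carrier_vec p'. \<Sum>I\<in>Pow {..<p'}. ?\<sigma> I *
      (?g u * (\<Sum>x\<in>UNIV. x ^ Q * (?S I u + x) ^ (CARD('a) - 1))))"
    unfolding sum_distrib_left by (intro sum.cong refl, subst sum.swap) (simp only: ac_simps)
  also have "\<dots> = (\<Sum>I\<in>Pow {..<p'}. ?\<sigma> I * (\<Sum>u\<in>carrier_vec p'.
      ?g u * ((\<Sum>x\<in>UNIV. x ^ Q) - (- ?S I u) ^ Q)))"
    unfolding sum_power_times_shifted_power by (subst sum.swap) (simp add: sum_distrib_left)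
  also have "\<dots> = (\<Sum>I\<in>Pow {..<p'}. if I = {..<p'} then
      (-1) ^ (p' + 1) * - ((-1) ^ Q * ((-1) ^ p' * of_nat (multinom p' (\<lambda>_. c) Q))) else 0)"
  proof (rule sum.cong[OF refl])
    fix I assume "I \<in> Pow {..<p'}"
    then have I: "I \<subseteq> {..<p'}" by simp
    \<comment> \<open>This removes the power sum of \<open>x ^ Q\<close>, which does not depend on
      \<open>u\<close>.\<close>
    have g0: "(\<Sum>u\<in>carrier_vec p'. ?g u) = 0"
      unfolding sum_carrier_vec_prod[where g = "\<lambda>_ x. x ^ (Q - 1)"] power_sum_eq_0[OF qc(4)]
      using p'(2) by simp
    have gw: "?g u = (-1) ^ p' * (\<Prod>j<p'. coeff_weight c (u $ j))" for u :: "'a vec"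
      using c(1) qc(2) by (simp add: coeff_weight_def prod_uminus power_mult_distrib[symmetric] mult.assoc[symmetric])
    have S: "?S I u = (\<Sum>j<p'. u $ j * (if j \<in> I then 1 else 0))" for u
      using I by (intro sum.mono_neutral_cong_left) auto
    have "(\<Sum>u\<in>carrier_vec p'. ?g u * ?S I u ^ Q) = (-1) ^ p' *
        (\<Sum>u\<in>carrier_vec p'. (\<Prod>j<p'. coeff_weight c (u $ j)) *
           (\<Sum>j<p'. u $ j * (if j \<in> I then 1 else 0)) ^ Q)"
      unfolding gw S by (simp add: sum_distrib_left mult.assoc)
    also have "\<dots> = (-1) ^ p' * (of_nat (multinom p' (\<lambda>_. c) Q) * (\<Prod>j<p'. (if j \<in> I then 1 else 0) ^ c))"
      using qc by (subst sum_coeff_weight_linear_power) auto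
    \<comment> \<open>A variable missing from \<open>I\<close> contributes \<open>0 ^ c\<close>,
      which is 0 because \<open>c > 0\<close>.\<close>
    also have "(\<Prod>j<p'. (if j \<in> I then 1 else 0) ^ c) = (if I = {..<p'} then 1 else (0::'a))"
    proof (cases "I = {..<p'}")
      case False
      then obtain j where "j < p'" "j \<notin> I" using I by blast
      then show ?thesis using False c(1) by (simp, intro bexI[of _ j]) auto
    qed auto
    finally have gS: "(\<Sum>u\<in>carrier_vec p'. ?g u * ?S I u ^ Q) =
        (if I = {..<p'} then (-1) ^ p' * of_nat (multinom p' (\<lambda>_. c) Q) else 0)" by simp
    have "(- ?S I u) ^ Q = (-1) ^ Q * ?S I u ^ Q" for u by (rule power_minus)
    then have "(\<Sum>u\<in>carrier_vec p'. ?g u * (C - (- ?S I u) ^ Q)) =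
       (\<Sum>u\<in>carrier_vec p'. ?g u) * C - (-1) ^ Q * (\<Sum>u\<in>carrier_vec p'. ?g u * ?S I u ^ Q)" for C
      by (simp only: right_diff_distrib sum_subtractf sum_distrib_left sum_distrib_right mult.left_commute)
    then show "?\<sigma> I * (\<Sum>u\<in>carrier_vec p'. ?g u * ((\<Sum>x\<in>UNIV. x ^ Q) - (- ?S I u) ^ Q)) =
       (if I = {..<p'} then
        (-1) ^ (p' + 1) * - ((-1) ^ Q * ((-1) ^ p' * of_nat (multinom p' (\<lambda>_. c) Q))) else 0)"
      unfolding g0 gS by auto
  qed
  also have "\<dots> = (-1) ^ (p' + 1) * - ((-1) ^ Q * ((-1) ^ p' * of_nat (multinom p' (\<lambda>_. c) Q)))"
    by simp
  also have "\<dots> \<noteq> 0"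
  proof -
    have "(of_nat (multinom p' (\<lambda>_. c) (\<Sum>j<p'. c)) :: 'a) \<noteq> 0"
    \<comment> \<open>Each part is \<open>p ^ k'\<close>, with the single digit 1 at position
      \<open>k'\<close>; the \<open>p - 1\<close> ones there do not carry.\<close>
    proof (rule of_nat_multinom_no_carry[OF p CHAR_eq_of_CARD_prime_power[OF p card],
          where k = k and x = "\<lambda>_ l. if l = k' then 1 else 0"])
      show "c = (\<Sum>l<k. (if l = k' then 1 else 0) * p ^ l)"
        using k by (simp add: c_def if_distrib[of "\<lambda>x. x * _"] cong: if_cong)
    qed (use p' in auto)
    then show ?thesis by (simp add: Qc)
  qed
  finally show ?thesis .
qed

text \<open>For \<open>j \<ge> p\<close> the argument of \<open>G\<close> would read past its block.
  The assumption that \<open>G\<close> depends on its first \<open>p\<close> values only is what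
  makes the sum factor.\<close>

lemma sum_carrier_vec_blocks:
  fixes G :: "(nat \<Rightarrow> 'a::finite) \<Rightarrow> 'b::comm_ring_1"
  assumes "\<And>x y. (\<And>j. j < p \<Longrightarrow> x j = y j) \<Longrightarrow> G x = G y"
  shows "(\<Sum>v\<in>carrier_vec (p * m). \<Prod>i<m. G (\<lambda>j. v $ (p * i + j))) =
     (\<Sum>v\<in>carrier_vec p. G (($) v)) ^ m"
proof (induction m)
  case 0
  then show ?case by (simp add: carrier_vec_0)
next
  case (Suc m)
  have "(\<Sum>v\<in>carrier_vec (p * Suc m). \<Prod>i<Suc m. G (\<lambda>j. v $ (p * i + j))) =
      (\<Sum>u\<in>carrier_vec (p * m). \<Sum>w\<in>carrier_vec p. \<Prod>i<Suc m. G (\<lambda>j. (u @\<^sub>v w) $ (p * i + j)))"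
    using sum_carrier_vec_append[of "\<lambda>v. \<Prod>i<Suc m. G (\<lambda>j. v $ (p * i + j))" "p * m" p]
    by (simp only: mult_Suc_right add.commute)
  also have "\<dots> = (\<Sum>u\<in>carrier_vec (p * m). \<Sum>w\<in>carrier_vec p.
      (\<Prod>i<m. G (\<lambda>j. u $ (p * i + j))) * G (($) w))"
  proof (intro sum.cong refl)
    fix u w :: "'a vec" assume uw: "u \<in> carrier_vec (p * m)" "w \<in> carrier_vec p"
    have "G (\<lambda>j. (u @\<^sub>v w) $ (p * i + j)) = G (\<lambda>j. u $ (p * i + j))" if "i < m" for i
    proof (rule assms)
      fix j assume "j < p"
      then have "p * i + j < p * Suc i" by simp
      also have "\<dots> \<le> p * m" using that by (intro mult_le_mono2) simp
      finally show "(u @\<^sub>v w) $ (p * i + j) = u $ (p * i + j)" using uw by simp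
    qed
    moreover have "G (\<lambda>j. (u @\<^sub>v w) $ (p * m + j)) = G (($) w)"
      by (rule assms) (use uw in simp)
    ultimately show "(\<Prod>i<Suc m. G (\<lambda>j. (u @\<^sub>v w) $ (p * i + j))) =
        (\<Prod>i<m. G (\<lambda>j. u $ (p * i + j))) * G (($) w)" by simp
  qed
  also have "\<dots> = (\<Sum>v\<in>carrier_vec p. G (($) v)) ^ Suc m"
    by (simp add: sum_distrib_left[symmetric] sum_distrib_right[symmetric] Suc.IH)
  finally show ?case .
qed

lemma prod_lessThan_add: "(\<Prod>j<a + b. g j) = (\<Prod>j<a. g j) * (\<Prod>j<b. g (a + j))"
  for g :: "nat \<Rightarrow> 'b::comm_monoid_mult"
  by (induction b) (auto simp: mult.assoc)

lemma prod_lessThan_blocks: "(\<Prod>j<p * m. g j) = (\<Prod>i<m. \<Prod>j<p. g (p * i + j))"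
  for g :: "nat \<Rightarrow> 'b::comm_monoid_mult"
proof (induction m)
  case (Suc m)
  have "(\<Prod>j<p * Suc m. g j) = (\<Prod>j<p * m + p. g j)" by (simp add: add.commute)
  then show ?case by (simp only: prod_lessThan_add Suc.IH prod.lessThan_Suc)
qed simp

text \<open>The first \<open>s\<close> coordinates give one nonzero factor per block of length
  \<open>p\<close>. Each of the last \<open>t\<close> has total exponent \<open>q - 1\<close> and
  gives the factor -1.\<close>

lemma sum_monom_sparse_H_nonzero:
  assumes p: "prime p" and card: "CARD('a::{field,finite}) = p ^ k"
    and Q: "Q = CARD('a) - CARD('a) div p" and s: "p dvd s"
    and b: "\<And>j. j < s \<Longrightarrow> b j = Q" "\<And>i. i < t \<Longrightarrow> b (s + i) + e $ i = CARD('a) - 1"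
  shows "(\<Sum>v\<in>carrier_vec (s + t). (\<Prod>j<s + t. (v $ j) ^ b j) * sparse_H p s t e v) \<noteq> (0 :: 'a)"
proof -
  have "p > 0" using p by (simp add: prime_gt_0_nat)
  obtain m where m: "s = p * m" using s by blast
  let ?P = "sparse_P p :: 'a mpoly"
  define G where "G x = (\<Prod>j<p. x j ^ Q) * eval_mpoly x ?P" for x
  have G: "G x = G y" if "\<And>j. j < p \<Longrightarrow> x j = y j" for x y
    unfolding G_def using that eval_mpoly_cong[OF sparse_P_bounded[OF \<open>p > 0\<close>], of x y] by simp
  have "(\<Sum>v\<in>carrier_vec (s + t). (\<Prod>j<s + t. (v $ j) ^ b j) * sparse_H p s t e v) =
      (\<Sum>u\<in>carrier_vec s. \<Sum>w\<in>carrier_vec t.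
         (\<Prod>i<m. G (\<lambda>j. u $ (p * i + j))) * (\<Prod>i<t. (w $ i) ^ (CARD('a) - 1)))"
    unfolding sum_carrier_vec_append
  proof (intro sum.cong refl)
    fix u w :: "'a vec" assume uw: "u \<in> carrier_vec s" "w \<in> carrier_vec t"
    have uw_s: "(u @\<^sub>v w) $ j = u $ j" if "j < s" for j using uw that by simp
    have uw_t: "(u @\<^sub>v w) $ (s + i) = w $ i" if "i < t" for i using uw that by simp
    have "(\<Prod>j<s + t. ((u @\<^sub>v w) $ j) ^ b j) =
        (\<Prod>j<s. (u $ j) ^ Q) * (\<Prod>i<t. (w $ i) ^ b (s + i))"
      unfolding prod_lessThan_add by (simp add: uw_s uw_t b(1))
    moreover have "(\<Prod>j<s. (u $ j) ^ Q) = (\<Prod>i<m. \<Prod>j<p. (u $ (p * i + j)) ^ Q)"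
      unfolding m prod_lessThan_blocks ..
    moreover have "sparse_H p s t e (u @\<^sub>v w) =
        (\<Prod>i<m. eval_mpoly (\<lambda>j. u $ (p * i + j)) ?P) * (\<Prod>i<t. (w $ i) ^ (e $ i))"
    proof -
      have "eval_mpoly (\<lambda>j. (u @\<^sub>v w) $ (p * i + j)) ?P = eval_mpoly (\<lambda>j. u $ (p * i + j)) ?P"
        if "i < m" for i
      proof (rule eval_mpoly_cong[OF sparse_P_bounded[OF \<open>p > 0\<close>]])
        fix j assume "j \<in> {..<p}"
        then have "p * i + j < p * Suc i" by simp
        also have "\<dots> \<le> p * m" using that by (intro mult_le_mono2) simp
        finally show "(u @\<^sub>v w) $ (p * i + j) = u $ (p * i + j)" by (simp add: uw_s m)
      qed
      then show ?thesis using \<open>p > 0\<close> by (simp add: sparse_H_def m uw_t[unfolded m])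
    qed
    moreover have "(\<Prod>i<t. (w $ i) ^ b (s + i)) * (\<Prod>i<t. (w $ i) ^ (e $ i)) =
        (\<Prod>i<t. (w $ i) ^ (CARD('a) - 1))"
      unfolding prod.distrib[symmetric] by (intro prod.cong refl) (simp add: b(2) power_add[symmetric])
    ultimately show "(\<Prod>j<s + t. ((u @\<^sub>v w) $ j) ^ b j) * sparse_H p s t e (u @\<^sub>v w) =
        (\<Prod>i<m. G (\<lambda>j. u $ (p * i + j))) * (\<Prod>i<t. (w $ i) ^ (CARD('a) - 1))"
      unfolding G_def prod.distrib by (simp add: ac_simps)
  qed
  also have "\<dots> = (\<Sum>v\<in>carrier_vec p. G (($) v)) ^ m * (-1) ^ t"
    unfolding sum_distrib_left[symmetric] sum_distrib_right[symmetric] m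
    by (subst sum_carrier_vec_blocks, erule G)
       (simp only: sum_carrier_vec_prod[where g = "\<lambda>_ x. x ^ (CARD('a) - 1)"]
         power_sum_CARD_minus_1 prod_constant card_lessThan)
  finally show ?thesis
    using sum_sparse_P_nonzero[OF p card Q] by (simp add: G_def)
qed

subsection \<open>Coefficient extraction over all affine maps\<close>

text \<open>The vanishing inner products are added up over all affine maps, with the product of the
  coefficient weights of all entries. This extracts the monomial with exponent \<open>c i j\<close>
  in entry \<open>(i, j)\<close>; its row sums determine \<open>a\<close>, so no other monomial of
  \<open>F\<close> survives.\<close>

lemma affine_coefficient_extraction:
  fixes F :: "'a::{field,finite} mpoly"
  assumes F: "F \<in> reduced_mpolys n" and f: "\<And>v. v \<in> carrier_vec n \<Longrightarrow> f v = eval_mpoly (($) v) F"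
    and zero: "\<And>T. T \<in> affine_maps M n \<Longrightarrow> fun_inner M (f \<circ> T) h = 0"
    and a: "a \<in> Poly_Mapping.keys F"
    and c: "\<And>i. i < n \<Longrightarrow> (\<Sum>j<Suc M. c i j) = Poly_Mapping.lookup a i"
  shows "Poly_Mapping.lookup F a * (\<Prod>i<n. of_nat (multinom (Suc M) (c i) (Poly_Mapping.lookup a i))) *
     (\<Sum>v\<in>carrier_vec M. (\<Prod>j<M. (v $ j) ^ (\<Sum>i<n. c i j)) * h v) = 0"
proof -
  let ?lk = "Poly_Mapping.lookup"
  have red: "Poly_Mapping.keys m \<subseteq> {..<n}" "?lk m i \<le> CARD('a) - 1"
    if "m \<in> Poly_Mapping.keys F" for m i
    using F that unfolding reduced_mpolys_def by blast+
  have c_le: "c i j \<le> CARD('a) - 1" if "i < n" "j < Suc M" for i j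
  proof -
    have "c i j \<le> (\<Sum>j<Suc M. c i j)" using that(2) by (intro member_le_sum) auto
    then show ?thesis using c[OF that(1)] red(2)[OF a, of i] by linarith
  qed
  \<comment> \<open>\<open>\<Lambda> i\<close> is row \<open>i\<close> of the matrix extended by the
    translation vector as column \<open>M\<close>; accordingly \<open>y v\<close> is
    \<open>v\<close> with a 1 appended.\<close>
  define L where "L = {..<n} \<rightarrow>\<^sub>E (carrier_vec (Suc M) :: 'a vec set)"
  define T where "T \<Lambda> = (\<lambda>x. mat n M (\<lambda>(i, j). \<Lambda> i $ j) *\<^sub>v x + vec n (\<lambda>i. \<Lambda> i $ M))"
    for \<Lambda> :: "nat \<Rightarrow> 'a vec"
  define y where "y v j = (if j < M then v $ j else 1)" for v :: "'a vec" and j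
  define W where "W \<Lambda> = (\<Prod>i<n. \<Prod>j<Suc M. coeff_weight (c i j) (\<Lambda> i $ j))" for \<Lambda> :: "nat \<Rightarrow> 'a vec"
  have T_aff: "T \<Lambda> \<in> affine_maps M n" for \<Lambda>
    unfolding affine_maps_def T_def by (intro CollectI exI conjI) (rule refl, auto)
  have fT: "f (T \<Lambda> v) = (\<Sum>m\<in>Poly_Mapping.keys F. ?lk F m *
      (\<Prod>i<n. (\<Sum>j<Suc M. \<Lambda> i $ j * y v j) ^ ?lk m i))" if v: "v \<in> carrier_vec M" for \<Lambda> v
  proof -
    have "T \<Lambda> v \<in> carrier_vec n" unfolding T_def using v
      by (auto intro!: add_carrier_vec mult_mat_vec_carrier[of _ n M])
    moreover have "T \<Lambda> v $ i = (\<Sum>j<Suc M. \<Lambda> i $ j * y v j)" if "i < n" for i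
      using that v by (simp add: T_def scalar_prod_def y_def lessThan_atLeast0)
    ultimately show ?thesis
      using red(1) by (simp add: f eval_mpoly_def eval_monom_superset[of "{..<n}"])
  qed
  let ?K = "\<Prod>i<n. of_nat (multinom (Suc M) (c i) (?lk a i)) :: 'a"
  \<comment> \<open>For fixed \<open>v\<close> both the weight and the monomial factor over the
    rows, so each row is summed separately.\<close>
  have row: "(\<Sum>\<Lambda>\<in>L. W \<Lambda> * (\<Prod>i<n. (\<Sum>j<Suc M. \<Lambda> i $ j * y v j) ^ ?lk m i)) =
      (if m = a then ?K * (\<Prod>j<M. (v $ j) ^ (\<Sum>i<n. c i j)) else 0)"
    if m: "m \<in> Poly_Mapping.keys F" for v m
  proof -
    have "(\<Sum>\<Lambda>\<in>L. W \<Lambda> * (\<Prod>i<n. (\<Sum>j<Suc M. \<Lambda> i $ j * y v j) ^ ?lk m i)) =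
        (\<Prod>i<n. \<Sum>u\<in>carrier_vec (Suc M).
           (\<Prod>j<Suc M. coeff_weight (c i j) (u $ j)) * (\<Sum>j<Suc M. u $ j * y v j) ^ ?lk m i)"
      unfolding W_def L_def prod.distrib[symmetric]
      by (rule prod_sum_PiE[symmetric]) auto
    also have "\<dots> = (\<Prod>i<n. of_nat (multinom (Suc M) (c i) (?lk m i)) * (\<Prod>j<Suc M. y v j ^ c i j))"
      using c_le red(2)[OF m] by (intro prod.cong refl sum_coeff_weight_linear_power) auto
    also have "\<dots> = (if m = a then ?K * (\<Prod>j<M. (v $ j) ^ (\<Sum>i<n. c i j)) else 0)"
    proof (cases "m = a")
      case True
      have "(\<Prod>i<n. \<Prod>j<Suc M. y v j ^ c i j) = (\<Prod>j<Suc M. y v j ^ (\<Sum>i<n. c i j))"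
        by (subst prod.swap) (simp only: power_sum)
      also have "\<dots> = (\<Prod>j<M. (v $ j) ^ (\<Sum>i<n. c i j))" by (simp add: y_def)
      finally show ?thesis using True by (simp only: prod.distrib simp_thms if_True)
    next
      case False
      \<comment> \<open>Where \<open>m\<close> and \<open>a\<close> differ, the parts
        \<open>c i j\<close> do not add up to the exponent in \<open>m\<close>, and the multinomial
        coefficient is 0.\<close>
      have "\<exists>i<n. ?lk m i \<noteq> ?lk a i"
      proof (rule ccontr)
        assume eq: "\<not> ?thesis"
        have "?lk m i = ?lk a i" for i
        proof (cases "i < n")
          case True
          then show ?thesis using eq by blast
        next
          case False
          then have "i \<notin> Poly_Mapping.keys m" "i \<notin> Poly_Mapping.keys a"
            using red(1)[OF m] red(1)[OF a] by auto
          then show ?thesis by (simp add: in_keys_iff)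
        qed
        then show False using \<open>m \<noteq> a\<close> by (simp add: poly_mapping_eqI)
      qed
      then obtain i where i: "i < n" "?lk m i \<noteq> ?lk a i" by blast
      then have "multinom (Suc M) (c i) (?lk m i) = 0" by (intro multinom_eq_0) (simp only: c)
      then show ?thesis using False i(1)
        by (simp only: if_False, intro prod_zero bexI[of _ i]) (simp_all del: multinom.simps)
    qed
    finally show ?thesis .
  qed
  have "0 = (\<Sum>\<Lambda>\<in>L. W \<Lambda> * fun_inner M (f \<circ> T \<Lambda>) h)" using zero[OF T_aff] by simp
  also have "\<dots> = (\<Sum>v\<in>carrier_vec M. \<Sum>\<Lambda>\<in>L. W \<Lambda> * f (T \<Lambda> v) * h v)"
    unfolding fun_inner_def sum_distrib_left by (subst sum.swap) (simp add: mult.assoc)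
  also have "\<dots> = (\<Sum>v\<in>carrier_vec M. \<Sum>\<Lambda>\<in>L. \<Sum>m\<in>Poly_Mapping.keys F. ?lk F m * h v *
      (W \<Lambda> * (\<Prod>i<n. (\<Sum>j<Suc M. \<Lambda> i $ j * y v j) ^ ?lk m i)))"
    by (intro sum.cong refl) (simp only: fT sum_distrib_left sum_distrib_right ac_simps)
  also have "\<dots> = (\<Sum>v\<in>carrier_vec M. \<Sum>m\<in>Poly_Mapping.keys F. ?lk F m * h v *
      (\<Sum>\<Lambda>\<in>L. W \<Lambda> * (\<Prod>i<n. (\<Sum>j<Suc M. \<Lambda> i $ j * y v j) ^ ?lk m i)))"
    unfolding sum_distrib_left by (intro sum.cong refl sum.swap)
  also have "\<dots> = (\<Sum>v\<in>carrier_vec M. \<Sum>m\<in>Poly_Mapping.keys F.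
      if m = a then ?lk F a * h v * (?K * (\<Prod>j<M. (v $ j) ^ (\<Sum>i<n. c i j))) else 0)"
    by (intro sum.cong refl) (simp only: row, simp)
  also have "\<dots> = ?lk F a * ?K * (\<Sum>v\<in>carrier_vec M. (\<Prod>j<M. (v $ j) ^ (\<Sum>i<n. c i j)) * h v)"
    using a by (simp add: sum_distrib_left ac_simps del: multinom.simps)
  finally show ?thesis by simp
qed

subsection \<open>The characterization\<close>

lemma poly_fun_sparse_H:
  assumes "p > 0" "p dvd s"
  shows "poly_fun (s + t) ((s div p) * (CARD('a) - p) + (\<Sum>i<t. e $ i))
     (sparse_H p s t e :: 'a::{field,finite} vec \<Rightarrow> 'a)"
proof -
  have "poly_fun (s + t) ((\<Sum>i<s div p. CARD('a) - p) + (\<Sum>i<t. e $ i * 1))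
     (\<lambda>x :: 'a vec. (\<Prod>i<s div p. eval_mpoly (\<lambda>j. x $ (p * i + j)) (sparse_P p)) *
        (\<Prod>i<t. (x $ (s + i)) ^ (e $ i)))"
  proof (intro poly_fun_mult poly_fun_prod poly_fun_power poly_fun_coord
      poly_fun_eval_mpoly[OF sparse_P_bounded[OF assms(1)]])
    fix i j assume "i \<in> {..<s div p}" "j \<in> {..<p}"
    then have "p * i + j < p * Suc i" by simp
    also have "\<dots> \<le> p * (s div p)" using \<open>i \<in> _\<close> by (intro mult_le_mono2) simp
    finally show "p * i + j < s + t" using assms(2) by simp
  qed simp
  then show ?thesis unfolding sparse_H_def[abs_def] by simp
qed

text \<open>Affine substitution does not raise the degree bound \<open>d\<close>, so the summand has
  degree below the threshold at which sums over the whole space can be nonzero.\<close>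

lemma fun_inner_affine_sparse_H_eq_0:
  fixes F :: "'a::{field,finite} mpoly"
  assumes F: "mpoly_bounded {..<n} d F" and f: "\<And>v. v \<in> carrier_vec n \<Longrightarrow> f v = eval_mpoly (($) v) F"
    and T: "T \<in> affine_maps (s + t) n" and p: "p > 0" "p dvd s"
    and deg: "d + ((s div p) * (CARD('a) - p) + (\<Sum>i<t. e $ i)) < (s + t) * (CARD('a) - 1)"
  shows "fun_inner (s + t) (f \<circ> T) (sparse_H p s t e) = 0"
proof -
  obtain A b where T: "T = (\<lambda>x. A *\<^sub>v x + b)" and A: "A \<in> carrier_mat n (s + t)" and b: "b \<in> carrier_vec n"
    using T unfolding affine_maps_def by blast
  let ?g = "\<lambda>i (v :: 'a vec). (\<Sum>j<s + t. A $$ (i, j) * v $ j) + b $ i"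
  have "f (T v) = eval_mpoly (\<lambda>i. ?g i v) F" if v: "v \<in> carrier_vec (s + t)" for v
  proof -
    have "T v \<in> carrier_vec n" unfolding T using A b v by simp
    moreover have "T v $ i = ?g i v" if "i < n" for i
      using that v A b by (simp add: T scalar_prod_def lessThan_atLeast0)
    ultimately show ?thesis by (simp add: f) (rule eval_mpoly_cong[OF F], simp)
  qed
  then have "fun_inner (s + t) (f \<circ> T) (sparse_H p s t e) =
      (\<Sum>v\<in>carrier_vec (s + t). eval_mpoly (\<lambda>i. ?g i v) F * sparse_H p s t e v)"
    unfolding fun_inner_def by simp
  also have "\<dots> = 0"
  proof (rule poly_fun_sum_eq_0[OF poly_fun_mult deg])
    have "poly_fun (s + t) 1 (?g i)" for i
      using poly_fun_mult[OF poly_fun_const[of _ 0] poly_fun_coord]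
      by (intro poly_fun.add poly_fun_sum poly_fun_const) simp
    then show "poly_fun (s + t) d (\<lambda>v. eval_mpoly (\<lambda>i. ?g i v) F)"
      using F by (intro poly_fun_eval_mpoly)
  qed (rule poly_fun_sparse_H[OF p])
  finally show ?thesis .
qed

theorem theorem3p4:
  fixes p k n d s r t :: nat
    and f :: "'a::{field,finite} vec \<Rightarrow> 'a"
  assumes "prime p"
    and "CARD('a) = p ^ k"
    and "n \<ge> 1"
    and "d \<ge> 1"
    and "d + 1 = s * (CARD('a) - CARD('a) div p) + r"
    and "p dvd s"
    and "0 < r"
    and "r \<le> p * (CARD('a) - CARD('a) div p)"
    and "t = max (p + 2) 10"
  shows "sparse_test_prob p n s t r f = 1 \<longleftrightarrow> fun_degree n f \<le> d"
proof -
  let ?q = "CARD('a)"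
  define Q where "Q = ?q - ?q div p"
  have p1: "p > 1" using assms(1) by (rule prime_gt_1_nat)
  have "k \<noteq> 0" using CARD_field_gt_1[where 'a = 'a] assms(2) by (intro notI) simp
  then obtain k' where k: "k = Suc k'" by (cases k) auto
  have q: "?q = p * p ^ k'" using assms(2) k by simp
  have qdiv: "?q div p = p ^ k'" unfolding q using p1 by (intro nonzero_mult_div_cancel_left) simp
  then have Q: "Q = (p - 1) * p ^ k'" unfolding Q_def q by (simp add: diff_mult_distrib)
  have "p \<le> ?q" "p ^ k' > 0" unfolding q using p1 by auto
  then have "Q \<le> ?q - 1" unfolding Q_def qdiv by linarith
  have d: "d + 1 = s * Q + r" and r: "r \<le> p * Q" using assms(5,8) by (simp_all add: Q_def)
  let ?F = "mpoly_of_fun n f"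
  note F = mpoly_of_fun[where n = n and f = f]
  have keysF: "Poly_Mapping.keys m \<subseteq> {..<n}" "Poly_Mapping.lookup m i \<le> ?q - 1"
    if "m \<in> Poly_Mapping.keys ?F" for m i
    using F(1) that unfolding reduced_mpolys_def by blast+
  show ?thesis unfolding sparse_test_prob_eq_1_iff
  proof
    assume deg: "fun_degree n f \<le> d"
    then have bounded: "mpoly_bounded {..<n} d ?F"
      using keysF(1) unfolding fun_degree_def total_degree_le_iff mpoly_bounded_def by blast
    show "\<forall>T\<in>affine_maps (s + t) n. \<forall>e\<in>valid_exps ?q t r.
        fun_inner (s + t) (f \<circ> T) (sparse_H p s t e) = 0"
    proof (intro ballI)
      fix T :: "'a vec \<Rightarrow> 'a vec" and e
      assume T: "T \<in> affine_maps (s + t) n" and e: "e \<in> valid_exps ?q t r"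
      obtain m where m: "s = p * m" using assms(6) by blast
      have "int (\<Sum>i<t. e $ i) \<le> int t * (int ?q - 1) - int r" using e by (simp add: valid_exps_def)
      also have "int t * (int ?q - 1) = int (t * (?q - 1))" using \<open>p \<le> ?q\<close> p1 by (simp add: of_nat_diff)
      finally have sum_e: "(\<Sum>i<t. e $ i) + r \<le> t * (?q - 1)" by linarith
      \<comment> \<open>Each block of \<open>p\<close> variables accounts for \<open>p * Q\<close>
        in \<open>d + 1\<close> and for \<open>q - p\<close> in the test function, together exactly
        \<open>p * (q - 1)\<close>. The strict inequality below comes from the 1 in
        \<open>d + 1\<close>.\<close>
      have "p * Q + (?q - p) = p * (?q - 1)"
        unfolding Q q using p1 \<open>p ^ k' > 0\<close> by (simp add: algebra_simps diff_mult_distrib2)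
      then have "s * Q + m * (?q - p) = s * (?q - 1)"
        unfolding m by (metis distrib_left mult.assoc mult.commute)
      then have "d + (s div p * (?q - p) + (\<Sum>i<t. e $ i)) < (s + t) * (?q - 1)"
        using d sum_e m p1 by (simp add: add_mult_distrib)
      then show "fun_inner (s + t) (f \<circ> T) (sparse_H p s t e) = 0"
        using bounded F(2) T p1 assms(6) by (intro fun_inner_affine_sparse_H_eq_0[of n d ?F]) auto
    qed
  next
    assume zero: "\<forall>T\<in>affine_maps (s + t) n. \<forall>e\<in>valid_exps ?q t r.
        fun_inner (s + t) (f \<circ> T) (sparse_H p s t e) = 0"
    show "fun_degree n f \<le> d"
    proof (rule ccontr)
      assume "\<not> fun_degree n f \<le> d"
      then obtain a where a: "a \<in> Poly_Mapping.keys ?F" "monom_degree a > d"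
        unfolding fun_degree_def total_degree_le_iff by (auto simp: not_le)
      let ?a = "Poly_Mapping.lookup a"
      define R where "R = (\<Sum>i<n. ?a i)"
      have R: "R \<ge> s * Q + r"
        using a(2) d monom_degree_superset[OF _ keysF(1)[OF a(1)]] by (simp add: R_def)
      have a_less: "?a i < p ^ k" for i
        using keysF(2)[OF a(1), of i] assms(2) \<open>p \<le> ?q\<close> p1 by linarith
      \<comment> \<open>\<open>Q\<close> is a multiple of \<open>q / p = p ^ k'\<close>, hence of
        every digit value that occurs.\<close>
      have dvdQ: "p ^ l dvd Q" if "l < k" for l
        using that unfolding Q k by (intro dvd_mult le_imp_power_dvd) simp
      obtain c where c: "\<And>i. i < n \<Longrightarrow> (\<Sum>j<Suc (s + t). c i j) = ?a i"
          "\<And>i. i < n \<Longrightarrow> (of_nat (multinom (Suc (s + t)) (c i) (?a i)) :: 'a) \<noteq> 0"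
          "\<And>j. j < s + t \<Longrightarrow> (\<Sum>i<n. c i j) = min Q (R - j * Q)"
        using exponent_splitting[OF assms(1) CHAR_eq_of_CARD_prime_power[OF assms(1,2)],
            where a = ?a and n = n and k = k and Q = Q and M = "s + t", OF a_less dvdQ]
        unfolding R_def by blast
      define b where "b j = (\<Sum>i<n. c i j)" for j
      \<comment> \<open>The exponents complete those of the last \<open>t\<close> coordinates to
        \<open>q - 1\<close>.\<close>
      define e where "e = vec t (\<lambda>i. ?q - 1 - b (s + i))"
      have bQ: "b j = Q" if "j < s" for j
      proof -
        have "Suc j * Q \<le> s * Q" using that by (intro mult_le_mono1) simp
        then show ?thesis using that R c(3)[of j] unfolding b_def by simp
      qed
      have b_le: "b j \<le> ?q - 1" if "j < s + t" for j
        using c(3)[OF that] \<open>Q \<le> ?q - 1\<close> unfolding b_def by simp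
      have be: "b (s + i) + e $ i = ?q - 1" if "i < t" for i
        using b_le[of "s + i"] that by (simp add: e_def)
      \<comment> \<open>The last \<open>t\<close> bins either are all full, with
        \<open>r \<le> p * Q \<le> t * Q\<close>, or hold everything beyond \<open>s * Q\<close>,
        which is at least \<open>r\<close>. This makes \<open>e\<close> valid.\<close>
      have "r \<le> min (t * Q) (R - s * Q)"
      proof -
        have "p * Q \<le> t * Q" using assms(9) by (intro mult_le_mono1) simp
        then show ?thesis using r R by linarith
      qed
      also have "\<dots> = (\<Sum>i<t. b (s + i))"
        unfolding sum_greedy_loads[symmetric] b_def
        by (intro sum.cong refl) (simp add: c(3) add_mult_distrib)
      finally have "r \<le> (\<Sum>i<t. b (s + i))" .
      moreover have "(\<Sum>i<t. b (s + i)) + (\<Sum>i<t. e $ i) = t * (?q - 1)"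
        unfolding sum.distrib[symmetric] by (simp add: be)
      ultimately have "(\<Sum>i<t. e $ i) + r \<le> t * (?q - 1)" by linarith
      then have "int (\<Sum>i<t. e $ i) + int r \<le> int (t * (?q - 1))" by linarith
      also have "int (t * (?q - 1)) = int t * (int ?q - 1)" using \<open>p \<le> ?q\<close> p1 by (simp add: of_nat_diff)
      finally have "e \<in> valid_exps ?q t r"
        unfolding valid_exps_def by (auto simp: e_def)
      then have "Poly_Mapping.lookup ?F a * (\<Prod>i<n. of_nat (multinom (Suc (s + t)) (c i) (?a i))) *
          (\<Sum>v\<in>carrier_vec (s + t). (\<Prod>j<s + t. (v $ j) ^ b j) * sparse_H p s t e v) = 0"
        using zero F a(1) c(1) unfolding b_def
        by (intro affine_coefficient_extraction[where f = f]) auto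
      moreover have "(\<Sum>v\<in>carrier_vec (s + t). (\<Prod>j<s + t. (v $ j) ^ b j) * sparse_H p s t e v) \<noteq> (0 :: 'a)"
        by (rule sum_monom_sparse_H_nonzero[OF assms(1,2) Q_def assms(6) bQ be])
      moreover have "(\<Prod>i<n. of_nat (multinom (Suc (s + t)) (c i) (?a i))) \<noteq> (0 :: 'a)"
        by (subst prod_zero_iff) (use c(2) in auto)
      ultimately show False using a(1) by (simp add: in_keys_iff del: multinom.simps)
    qed
  qed
qed

end
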